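(* Let $(X,T,\mathcal{A},\mu)$ be a conservative ergodic measure preserving dynamical system, where $\mu$ is an infinite $\sigma$-finite measure. Let $A\in\mathcal{A}$ with $0<\mu(A)<\infty$ be a uniform set. If the wandering rate $(W_n)=(W_n(A))$ is regularly varying with exponent $1$, then $$\Gamma_n\stackrel{\mathcal{L}(\mu)}{\Longrightarrow}\boldsymbol{U}\qquad\text{and}\qquad\Theta_n\stackrel{\mathcal{L}(\mu)}{\Longrightarrow}\boldsymbol{U},$$ where $\boldsymbol{U}$ denotes a random variable uniformly distributed on the unit interval $[0,1]$.
   Context: $\mathcal{P}_\mu$ is the set of probability measures $\nu$ on $\mathcal{A}$ with $\nu\ll\mu$; the same symbol also denotes the set of the corresponding densities with respect to $\mu$. Transfer operator: $\hat T:L_1(\mu)\to L_1(\mu)$ is the positive linear operator characterized by $\int_B\hat T(f)\,d\mu=\int_{T^{-1}(B)}f\,d\mu$ for all $f\in L_1(\mu)$, $B\in\mathcal{A}$. Uniform sets: a set $A\in\mathcal{A}$ with $0<\mu(A)<\infty$ is uniform for $f\in\mathcal{P}_\mu$ if there is a sequence $(d_n)$ of positive reals such that $\frac1{d_n}\sum_{k=0}^{n-1}\hat T^k(f)\to1$ $\mu$-a.e. uniformly on $A$ (i.e. in $L_\infty(\mu|_A)$). $A$ is a uniform set if it is uniform for some $f\in\mathcal{P}_\mu$. For fixed $A$: $A_n:=\bigcup_{k=0}^nT^{-k}A$; the first return time is $\varphi(x)=\inf\{n\ge1:T^n(x)\in A\}$, $x\in X$; the wandering rate is $W_n=W_n(A):=\mu(A_n)=\sum_{k=0}^n\mu(A\cap\{\varphi>k\})$,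 $n\ge0$. Processes: $Z_n(x):=\max\{k\le n:T^k(x)\in A\}$ (with $k\geq 0$) if $x\in A_n$ and $Z_n(x):=0$ otherwise; $Y_n(x):=\min\{k>n:T^k(x)\in A\}$; $V_n:=Y_n-Z_n$. (By conservativity and ergodicity $Y_n<\infty$ $\mu$-a.e.) Moreover $$\Gamma_n:=\frac{n\sum_{k=0}^{V_n}\mu(A\cap\{\varphi>k\})}{\mu(A_n)\,V_n},\qquad\Theta_n:=\frac{n\sum_{k=0}^{Y_n}\mu(A\cap\{\varphi>k\})}{\mu(A_n)\,Y_n}.$$ Strong distributional convergence: $R_n\stackrel{\mathcal{L}(\mu)}{\Longrightarrow}R$ means that for every $\nu\in\mathcal{P}_\mu$, $R_n$ converges in distribution to $R$ with respect to $\nu$. Regular variation: a measurable $R:\mathbb{R}^+\to\mathbb{R}$ with $R>0$ on some $(a,\infty)$, $a>0$, is regularly varying (at $\infty$) with exponent $\rho\in\mathbb R$ if $\lim_{t\to\infty}R(\lambda t)/R(t)=\lambda^\rho$ for all $\lambda>0$; a sequence $(u_n)$ is regularly varying with exponent $\rho$ if $u_n=R(n)$, $n\ge1$, for such an $R$. *)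

theory Defs
  imports "HOL-Probability.Probability"
begin

definition measure_preserving :: "'a measure \<Rightarrow> ('a \<Rightarrow> 'a) \<Rightarrow> bool" where
  "measure_preserving M T \<longleftrightarrow> T \<in> measurable M M \<and> distr M M T = M"

definition preimage_iter :: "'a measure \<Rightarrow> ('a \<Rightarrow> 'a) \<Rightarrow> nat \<Rightarrow> 'a set \<Rightarrow> 'a set" where
  "preimage_iter M T k B = (T ^^ k) -` B \<inter> space M"

definition wandering :: "'a measure \<Rightarrow> ('a \<Rightarrow> 'a) \<Rightarrow> 'a set \<Rightarrow> bool" where
  "wandering M T B \<longleftrightarrow> B \<in> sets M \<and> disjoint_family (\<lambda>n. preimage_iter M T n B)"

definition conservative :: "'a measure \<Rightarrow> ('a \<Rightarrow> 'a) \<Rightarrow> bool" where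
  "conservative M T \<longleftrightarrow> (\<forall>B. wandering M T B \<longrightarrow> B \<in> null_sets M)"

definition ergodic :: "'a measure \<Rightarrow> ('a \<Rightarrow> 'a) \<Rightarrow> bool" where
  "ergodic M T \<longleftrightarrow>
     (\<forall>B\<in>sets M. preimage_iter M T 1 B = B \<longrightarrow> B \<in> null_sets M \<or> space M - B \<in> null_sets M)"

definition ac_probs :: "'a measure \<Rightarrow> 'a measure set" where
  "ac_probs M = {N. prob_space N \<and> sets N = sets M \<and> absolutely_continuous M N}"

definition ac_prob_densities :: "'a measure \<Rightarrow> ('a \<Rightarrow> real) set" where
  "ac_prob_densities M =
     {f \<in> borel_measurable M. (AE x in M. 0 \<le> f x) \<and> density M (\<lambda>x. ennreal (f x)) \<in> ac_probs M}"

(* Elements of L_1 are represented by functions, so the operator picks some version of the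
   a.e. uniquely determined image; see transfer_op_integrable, transfer_op_set_integral
   and transfer_op_unique. *)
definition transfer_op :: "'a measure \<Rightarrow> ('a \<Rightarrow> 'a) \<Rightarrow> ('a \<Rightarrow> real) \<Rightarrow> 'a \<Rightarrow> real" where
  "transfer_op M T f = (SOME g. integrable M g \<and>
     (\<forall>B\<in>sets M. (LINT x:B|M. g x) = (LINT x:preimage_iter M T 1 B|M. f x)))"

(* Convergence in L_infinity of A amounts to uniform convergence off a null set. *)
definition uniform_for :: "'a measure \<Rightarrow> ('a \<Rightarrow> 'a) \<Rightarrow> 'a set \<Rightarrow> ('a \<Rightarrow> real) \<Rightarrow> bool" where
  "uniform_for M T A f \<longleftrightarrow>
     (\<exists>d :: nat \<Rightarrow> real. (\<forall>n. 0 < d n) \<and>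
       (\<exists>N\<in>null_sets M.
          uniform_limit (A - N) (\<lambda>n x. (\<Sum>k<n. (transfer_op M T ^^ k) f x) / d n) (\<lambda>x. 1)
            sequentially))"

definition uniform_set :: "'a measure \<Rightarrow> ('a \<Rightarrow> 'a) \<Rightarrow> 'a set \<Rightarrow> bool" where
  "uniform_set M T A \<longleftrightarrow> A \<in> sets M \<and> 0 < emeasure M A \<and> emeasure M A < \<infinity> \<and>
     (\<exists>f\<in>ac_prob_densities M. uniform_for M T A f)"

definition visited_set :: "'a measure \<Rightarrow> ('a \<Rightarrow> 'a) \<Rightarrow> 'a set \<Rightarrow> nat \<Rightarrow> 'a set" where
  "visited_set M T A n = (\<Union>k\<le>n. preimage_iter M T k A)"

definition return_time :: "('a \<Rightarrow> 'a) \<Rightarrow> 'a set \<Rightarrow> 'a \<Rightarrow> enat" where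
  "return_time T A x = Inf {enat n | n. 1 \<le> n \<and> (T ^^ n) x \<in> A}"

definition wandering_rate :: "'a measure \<Rightarrow> ('a \<Rightarrow> 'a) \<Rightarrow> 'a set \<Rightarrow> nat \<Rightarrow> real" where
  "wandering_rate M T A n = measure M (visited_set M T A n)"

definition tail_sum :: "'a measure \<Rightarrow> ('a \<Rightarrow> 'a) \<Rightarrow> 'a set \<Rightarrow> nat \<Rightarrow> real" where
  "tail_sum M T A n = (\<Sum>k\<le>n. measure M {x \<in> A. enat k < return_time T A x})"

definition last_visit :: "'a measure \<Rightarrow> ('a \<Rightarrow> 'a) \<Rightarrow> 'a set \<Rightarrow> nat \<Rightarrow> 'a \<Rightarrow> nat" where
  "last_visit M T A n x =
     (if x \<in> visited_set M T A n then Max {k. k \<le> n \<and> (T ^^ k) x \<in> A} else 0)"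

(* If the orbit of x never visits A after time n (a null set of points in the conservative
   ergodic case), the value is an arbitrary constant. *)
definition next_visit :: "('a \<Rightarrow> 'a) \<Rightarrow> 'a set \<Rightarrow> nat \<Rightarrow> 'a \<Rightarrow> nat" where
  "next_visit T A n x = (LEAST k. n < k \<and> (T ^^ k) x \<in> A)"

(* Truncated subtraction is harmless: last_visit \<le> n < next_visit whenever A is visited
   after time n. *)
definition spanning_time :: "'a measure \<Rightarrow> ('a \<Rightarrow> 'a) \<Rightarrow> 'a set \<Rightarrow> nat \<Rightarrow> 'a \<Rightarrow> nat" where
  "spanning_time M T A n x = next_visit T A n x - last_visit M T A n x"

definition Gamma_proc :: "'a measure \<Rightarrow> ('a \<Rightarrow> 'a) \<Rightarrow> 'a set \<Rightarrow> nat \<Rightarrow> 'a \<Rightarrow> real" where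
  "Gamma_proc M T A n x =
     real n * tail_sum M T A (spanning_time M T A n x) /
     (measure M (visited_set M T A n) * real (spanning_time M T A n x))"

definition Theta_proc :: "'a measure \<Rightarrow> ('a \<Rightarrow> 'a) \<Rightarrow> 'a set \<Rightarrow> nat \<Rightarrow> 'a \<Rightarrow> real" where
  "Theta_proc M T A n x =
     real n * tail_sum M T A (next_visit T A n x) /
     (measure M (visited_set M T A n) * real (next_visit T A n x))"

(* The limit variable is given by its law L. *)
definition strong_conv_distr :: "'a measure \<Rightarrow> (nat \<Rightarrow> 'a \<Rightarrow> real) \<Rightarrow> real measure \<Rightarrow> bool" where
  "strong_conv_distr M R L \<longleftrightarrow>
     (\<forall>n. R n \<in> borel_measurable M) \<and>
     (\<forall>N\<in>ac_probs M. weak_conv_m (\<lambda>n. distr N borel (R n)) L)"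

(* Only the values of R on the positive half-line matter. *)
definition regularly_varying :: "(real \<Rightarrow> real) \<Rightarrow> real \<Rightarrow> bool" where
  "regularly_varying R \<rho> \<longleftrightarrow>
     R \<in> borel_measurable (restrict_space borel {0<..}) \<and>
     (\<exists>a>0. \<forall>t>a. 0 < R t) \<and>
     (\<forall>c>0. ((\<lambda>t. R (c * t) / R t) \<longlongrightarrow> c powr \<rho>) at_top)"

definition regularly_varying_seq :: "(nat \<Rightarrow> real) \<Rightarrow> real \<Rightarrow> bool" where
  "regularly_varying_seq u \<rho> \<longleftrightarrow>
     (\<exists>R. regularly_varying R \<rho> \<and> (\<forall>n\<ge>1. u n = R (real n)))"

lemma transfer_exists_nonneg:
  fixes f :: "'a \<Rightarrow> real"
  assumes sf: "sigma_finite_measure M" and T: "measure_preserving M T"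
    and f: "integrable M f" and nn: "\<And>x. 0 \<le> f x"
  shows "\<exists>g. integrable M g \<and>
     (\<forall>B\<in>sets M. (LINT x:B|M. g x) = (LINT x:preimage_iter M T 1 B|M. f x))"
proof -
  interpret sigma_finite_measure M by (rule sf)
  have Tm[measurable]: "T \<in> measurable M M" and Td: "distr M M T = M"
    using T by (auto simp: measure_preserving_def)
  have fm[measurable]: "f \<in> borel_measurable M" using f by auto
  define D where "D = density M (\<lambda>x. ennreal (f x))"
  define N where "N = distr D M T"
  have TD[measurable]: "T \<in> measurable D M" by (simp add: D_def)
  have sN[simp]: "sets N = sets M" "space N = space M" by (auto simp: N_def)
  have eN: "emeasure N B = (\<integral>\<^sup>+x\<in>preimage_iter M T 1 B. ennreal (f x) \<partial>M)" if "B \<in> sets M" for B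
    using that unfolding N_def D_def preimage_iter_def
    by (simp add: emeasure_distr emeasure_density)
  have pm: "preimage_iter M T 1 B \<in> sets M" if "B \<in> sets M" for B
    using that by (simp add: preimage_iter_def)
  have fin: "(\<integral>\<^sup>+x. ennreal (f x) \<partial>M) < \<infinity>"
    using f nn by (simp add: nn_integral_eq_integral)
  have finN: "finite_measure N"
  proof (rule finite_measureI)
    have "emeasure N (space N) \<le> (\<integral>\<^sup>+x. ennreal (f x) \<partial>M)"
      by (simp add: eN) (auto intro!: nn_integral_mono simp: indicator_def)
    then show "emeasure N (space N) \<noteq> \<infinity>" using fin by auto
  qed
  have ac: "absolutely_continuous M N"
    unfolding absolutely_continuous_def
  proof
    fix B assume B: "B \<in> null_sets M"
    then have "emeasure (distr M M T) B = 0" "B \<in> sets M" using Td by auto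
    then have "preimage_iter M T 1 B \<in> null_sets M"
      using pm[of B] by (auto simp: emeasure_distr preimage_iter_def intro!: null_setsI)
    then have "emeasure N B = 0" using B
      by (subst eN) (auto simp: nn_integral_null_set)
    then show "B \<in> null_sets N" using B by (intro null_setsI) (simp_all add: null_setsD2)
  qed
  obtain h where h: "h \<in> borel_measurable M"
    "AE x in M. RN_deriv M N x = ennreal (h x)" "\<And>x. 0 \<le> h x"
    using real_RN_deriv[OF finN ac] sN by metis
  have [measurable]: "h \<in> borel_measurable M" by (rule h)
  have dN: "emeasure N B = (\<integral>\<^sup>+x\<in>B. ennreal (h x) \<partial>M)" if "B \<in> sets M" for B
  proof -
    have "emeasure N B = emeasure (density M (RN_deriv M N)) B"
      using density_RN_deriv[OF ac] sN by simp
    also have "\<dots> = (\<integral>\<^sup>+x\<in>B. ennreal (h x) \<partial>M)"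
      using that h(2) by (subst emeasure_density) (auto intro!: nn_integral_cong_AE)
    finally show ?thesis .
  qed
  have ih: "integrable M h"
  proof (rule integrableI_nonneg)
    have "emeasure N (space M) = (\<integral>\<^sup>+x. ennreal (h x) \<partial>M)"
      by (subst dN) (auto intro!: nn_integral_cong simp: indicator_def)
    then show "(\<integral>\<^sup>+x. ennreal (h x) \<partial>M) < \<infinity>"
      using finite_measure.emeasure_finite[OF finN, of "space M"] by (simp add: less_top)
  qed (auto simp: h)
  have key: "ennreal (LINT x:B|M. g x) = (\<integral>\<^sup>+x\<in>B. ennreal (g x) \<partial>M)"
    if "B \<in> sets M" "integrable M g" "\<And>x. 0 \<le> g x" for g :: "'a \<Rightarrow> real" and B
  proof -
    have "(\<integral>\<^sup>+x\<in>B. ennreal (g x) \<partial>M) = (\<integral>\<^sup>+x. ennreal (indicator B x * g x) \<partial>M)"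
      by (auto intro!: nn_integral_cong simp: indicator_def)
    also have "\<dots> = ennreal (LINT x|M. indicator B x * g x)"
      using that integrable_mult_indicator[of B M g] by (intro nn_integral_eq_integral) auto
    finally show ?thesis by (simp add: set_lebesgue_integral_def)
  qed
  have "(LINT x:B|M. h x) = (LINT x:preimage_iter M T 1 B|M. f x)" if B: "B \<in> sets M" for B
  proof -
    have "ennreal (LINT x:B|M. h x) = ennreal (LINT x:preimage_iter M T 1 B|M. f x)"
      using key[OF B ih h(3)] key[OF pm[OF B] f nn] eN[OF B] dN[OF B] by simp
    moreover have "0 \<le> (LINT x:B|M. h x)" "0 \<le> (LINT x:preimage_iter M T 1 B|M. f x)"
      using h(3) nn by (auto simp: set_lebesgue_integral_def intro!: integral_nonneg_AE)
    ultimately show ?thesis by simp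
  qed
  then show ?thesis using ih by blast
qed

lemma transfer_exists:
  fixes f :: "'a \<Rightarrow> real"
  assumes sf: "sigma_finite_measure M" and T: "measure_preserving M T" and f: "integrable M f"
  shows "\<exists>g. integrable M g \<and>
     (\<forall>B\<in>sets M. (LINT x:B|M. g x) = (LINT x:preimage_iter M T 1 B|M. f x))"
proof -
  have Tm[measurable]: "T \<in> measurable M M" using T by (auto simp: measure_preserving_def)
  have ip: "integrable M (\<lambda>x. max 0 (f x))" and im: "integrable M (\<lambda>x. max 0 (- f x))"
    using f by auto
  obtain g where g: "integrable M g"
    "\<And>B. B \<in> sets M \<Longrightarrow> (LINT x:B|M. g x) = (LINT x:preimage_iter M T 1 B|M. max 0 (f x))"
    using transfer_exists_nonneg[OF sf T ip] by auto
  obtain h where h: "integrable M h"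
    "\<And>B. B \<in> sets M \<Longrightarrow> (LINT x:B|M. h x) = (LINT x:preimage_iter M T 1 B|M. max 0 (- f x))"
    using transfer_exists_nonneg[OF sf T im] by auto
  have si: "set_integrable M B u" if "B \<in> sets M" "integrable M u" for B and u :: "'a \<Rightarrow> real"
    using that integrable_mult_indicator[of B M u] by (simp add: set_integrable_def)
  have "(LINT x:B|M. g x - h x) = (LINT x:preimage_iter M T 1 B|M. f x)" if B: "B \<in> sets M" for B
  proof -
    have pB: "preimage_iter M T 1 B \<in> sets M" using B by (simp add: preimage_iter_def)
    have "(LINT x:B|M. g x - h x) = (LINT x:preimage_iter M T 1 B|M. max 0 (f x) - max 0 (- f x))"
      using set_integral_diff(2)[OF si[OF B g(1)] si[OF B h(1)]]
        set_integral_diff(2)[OF si[OF pB ip] si[OF pB im]] g(2)[OF B] h(2)[OF B] by simp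
    also have "(\<lambda>x. max 0 (f x) - max 0 (- f x)) = f" by (auto simp: max_def)
    finally show ?thesis .
  qed
  then show ?thesis using g(1) h(1) by (intro exI[of _ "\<lambda>x. g x - h x"]) auto
qed

lemma
  assumes "sigma_finite_measure M" and "measure_preserving M T" and "integrable M f"
  shows transfer_op_integrable: "integrable M (transfer_op M T f)"
    and transfer_op_set_integral: "B \<in> sets M \<Longrightarrow>
      (LINT x:B|M. transfer_op M T f x) = (LINT x:preimage_iter M T 1 B|M. f x)"
  using someI_ex[OF transfer_exists[OF assms]] unfolding transfer_op_def by auto

lemma transfer_op_unique:
  assumes "sigma_finite_measure M" and "measure_preserving M T" and "integrable M f"
    and "integrable M g"
    and "\<And>B. B \<in> sets M \<Longrightarrow> (LINT x:B|M. g x) = (LINT x:preimage_iter M T 1 B|M. f x)"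
  shows "AE x in M. transfer_op M T f x = g x"
  using assms transfer_op_integrable[OF assms(1-3)] transfer_op_set_integral[OF assms(1-3)]
  by (intro density_unique_real) auto

end

theory Submission
  imports Defs
begin

text \<open>
  Let $q_k = \mu(A \cap \{\varphi > k\})$, so that $W_n = \sum_{k \le n} q_k$, and let $w(n) = W_n / n$.
  Both processes have the form $w(U_n) / w(n)$ with $Y_n - n \le U_n \le Y_n$. Regular variation
  with exponent 1 and monotonicity make $q_n \sim w(n)$ slowly varying. For the measure $\nu_0$ with the
  density for which $A$ is uniform, decomposing the event of no visit during $(m, z]$ according to
  the last visit up to time $m$ bounds its probability between $b_m q_z$ and $b_m q_{z-m}$
  asymptotically, where $b_m \sim 1 / w(m)$. As $w$ is nonincreasing, $w(Y_n) \le t\,w(n)$ means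
  $Y_n \ge y$ for a level $y$ that is much larger than $n$ and has $w(y) \sim t\,w(n)$, so this event has
  $\nu_0$-probability close to $q_y / w(n) \sim t$.

  To pass from $\nu_0$ to any other $\nu \ll \mu$, averages of these events over $L_n \to \infty$ shifts
  are asymptotically $T$-invariant, and by ergodicity asymptotically invariant bounded functions
  have asymptotically the same integral with respect to all $\nu \ll \mu$.
\<close>

section \<open>Asymptotically invariant functions\<close>


text \<open>Uniformity controls the expected number of visits to one fixed subset of
  \<open>A\<close> at a time, with an error relative to its measure, whereas the last-visit
  decomposition needs a set that changes with the time of the visit. Monotonicity of the excursions
  replaces it by a fixed set from either side, and the two bounds meet in the limit because the
  level \<open>y\<close> outgrows every multiple of \<open>n\<close>. The same separation of scales
  absorbs all other displacements of order \<open>n\<close>: the gap between \<open>U_n\<close> and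
  \<open>Y_n\<close>, and a number of averaging shifts as large as \<open>n\<close>. Regular
  variation enters through \<open>W (2 * n) / W n\<close>, whose limit 2 spreads by monotonicity to
  all indices of bounded ratio. For the change of measure, cluster points are taken along filters
  finer than \<open>sequentially\<close>, so that Tychonoff's theorem provides the weak-star
  compactness without any separability of L_1.\<close>

text \<open>Tychonoff's theorem: all functions \<open>f n\<close> live in one product of compact
  intervals, so the image filter has a cluster point there. A filter stands in for a subsequence
  because the index set may be uncountable.\<close>

lemma bounded_functions_cluster_point:
  fixes f :: "'n \<Rightarrow> 'i \<Rightarrow> real"
  assumes F: "F \<noteq> bot" and bd: "\<And>n i. \<bar>f n i\<bar> \<le> c i"
  obtains G L where "G \<le> F" "G \<noteq> bot" "\<And>i. ((\<lambda>n. f n i) \<longlongrightarrow> L i) G"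
proof -
  define K where "K = (PiE UNIV (\<lambda>i. {- c i..c i}))"
  have "compactin (product_topology (\<lambda>i::'i. euclidean :: real topology) UNIV) K"
    unfolding K_def by (subst compactin_PiE) auto
  then have cK: "compact K" by (simp add: euclidean_product_topology)
  have "eventually (\<lambda>y. y \<in> K) (filtermap f F)"
    using bd by (auto simp: K_def eventually_filtermap abs_le_iff intro!: always_eventually)
      (metis minus_le_iff)
  moreover have "filtermap f F \<noteq> bot" using F by (simp add: filtermap_bot_iff)
  ultimately obtain L where L: "inf (nhds L) (filtermap f F) \<noteq> bot"
    using cK unfolding compact_filter by blast
  \<comment> \<open>Pulling the neighbourhoods of \<open>L\<close> back along \<open>f\<close>
    forces convergence to \<open>L\<close>; that \<open>L\<close> is a cluster point is exactly what
    keeps the meet with \<open>F\<close> proper.\<close>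
  define G where "G = inf (filtercomap f (nhds L)) F"
  have "G \<noteq> bot"
  proof
    assume "G = bot"
    then have "eventually (\<lambda>_. False) G" by simp
    then obtain Q R where Q: "eventually Q (filtercomap f (nhds L))" and R: "eventually R F"
      and QR: "\<And>x. Q x \<Longrightarrow> R x \<Longrightarrow> False"
      unfolding G_def eventually_inf by auto
    from Q obtain Q' where Q': "eventually Q' (nhds L)" "\<And>x. Q' (f x) \<Longrightarrow> Q x"
      by (auto simp: eventually_filtercomap)
    have "eventually (\<lambda>y. \<not> Q' y) (filtermap f F)"
      unfolding eventually_filtermap using R by (rule eventually_mono) (use Q' QR in auto)
    then have "eventually (\<lambda>_. False) (inf (nhds L) (filtermap f F))"
      unfolding eventually_inf using Q'(1) by blast
    with L show False by (simp add: trivial_limit_def)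
  qed
  moreover have "filterlim f (nhds L) G"
    unfolding G_def filterlim_def filtermap_le_iff_le_filtercomap by simp
  then have "\<And>i. ((\<lambda>n. f n i) \<longlongrightarrow> L i) G"
  proof -
    fix i
    show "((\<lambda>n. f n i) \<longlongrightarrow> L i) G"
    proof (rule topological_tendstoI)
      fix S assume S: "open S" "L i \<in> S"
      have "open ((\<lambda>y::'i \<Rightarrow> real. y i) -` S)"
        using S(1) by (intro open_vimage continuous_on_product_coordinates)
      then have "eventually (\<lambda>y. y \<in> (\<lambda>y. y i) -` S) (nhds L)"
        using S(2) by (auto simp: eventually_nhds)
      then show "eventually (\<lambda>n. f n i \<in> S) G"
        using \<open>filterlim f (nhds L) G\<close> unfolding filterlim_iff by fastforce
    qed
  qed
  moreover have "G \<le> F" by (simp add: G_def)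
  ultimately show thesis by (rule that[rotated 1])
qed

lemma (in finite_measure) AE_le_1_of_integral_le:
  assumes h: "integrable M (h :: 'a \<Rightarrow> real)"
    and le: "\<And>B. B \<in> sets M \<Longrightarrow> (LINT x|M. indicator B x * h x) \<le> measure M B"
  shows "AE x in M. h x \<le> 1"
proof -
  have [measurable]: "h \<in> borel_measurable M" using h by auto
  define D where "D = {x\<in>space M. 1 < h x}"
  have D[measurable]: "D \<in> sets M" unfolding D_def by measurable
  have i1: "integrable M (\<lambda>x. indicator D x * h x)"
    using integrable_mult_indicator[OF D h] by simp
  have i2: "integrable M (indicator D :: 'a \<Rightarrow> real)" by (simp add: less_top[symmetric])
  have "(LINT x|M. indicator D x * (h x - 1)) = (LINT x|M. indicator D x * h x) - measure M D"
    using i1 i2 by (simp add: right_diff_distrib Bochner_Integration.integral_diff)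
  also have "\<dots> \<le> 0" using le[OF D] by simp
  finally have le0: "(LINT x|M. indicator D x * (h x - 1)) \<le> 0" .
  have nn: "AE x in M. 0 \<le> indicator D x * (h x - 1)" by (auto simp: D_def indicator_def)
  have ii: "integrable M (\<lambda>x. indicator D x * (h x - 1))"
    using i1 i2 by (simp add: right_diff_distrib)
  have "(LINT x|M. indicator D x * (h x - 1)) = 0"
    using le0 integral_nonneg_AE[OF nn] by simp
  then have "AE x in M. indicator D x * (h x - 1) = 0"
    using integral_nonneg_eq_0_iff_AE[OF ii nn] by simp
  moreover have "AE x in M. x \<in> space M" by (rule AE_space)
  ultimately show ?thesis
    by eventually_elim (auto simp: D_def indicator_def split: if_splits)
qed

text \<open>Weak-star compactness of the unit ball of $L_\infty$: the cluster point is the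
  Radon-Nikodym density of the limiting set function.\<close>

lemma (in finite_measure) weak_star_cluster_point:
  fixes \<Phi> :: "nat \<Rightarrow> 'a \<Rightarrow> real"
  assumes F: "F \<noteq> bot"
    and meas[measurable]: "\<And>n. \<Phi> n \<in> borel_measurable M"
    and bd: "\<And>n x. 0 \<le> \<Phi> n x" "\<And>n x. \<Phi> n x \<le> 1"
  obtains G h where "G \<le> F" "G \<noteq> bot" "h \<in> borel_measurable M"
    "\<And>x. 0 \<le> h x" "\<And>x. h x \<le> 1"
    "\<And>g. integrable M g \<Longrightarrow> ((\<lambda>n. LINT x|M. \<Phi> n x * g x) \<longlongrightarrow> (LINT x|M. h x * g x)) G"
proof -
  \<comment> \<open>The value 0 off the integrable functions lets the index range over all
    functions, with \<open>LINT x|M. \<bar>g x\<bar>\<close> bounding every coordinate.\<close>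
  define f where "f = (\<lambda>n (g::'a \<Rightarrow> real). if integrable M g then LINT x|M. \<Phi> n x * g x else 0)"
  have int: "integrable M (\<lambda>x. \<Phi> n x * g x)" if "integrable M g" for n g
    using that by (rule Bochner_Integration.integrable_bound)
      (use that bd in \<open>auto simp: abs_mult intro!: mult_left_le_one_le\<close>)
  have bnd: "\<bar>LINT x|M. \<Phi> n x * g x\<bar> \<le> (LINT x|M. \<bar>g x\<bar>)" if "integrable M g" for n g
  proof -
    have "\<bar>LINT x|M. \<Phi> n x * g x\<bar> \<le> (LINT x|M. \<bar>\<Phi> n x * g x\<bar>)" by (rule integral_abs_bound)
    also have "\<dots> \<le> (LINT x|M. \<bar>g x\<bar>)"
      by (rule integral_mono) (use that integrable_abs[OF int[OF that]] bd in
          \<open>auto simp: abs_mult intro!: mult_left_le_one_le\<close>)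
    finally show ?thesis .
  qed
  have fbd: "\<bar>f n g\<bar> \<le> (LINT x|M. \<bar>g x\<bar>)" for n g
    using bnd[of g n] by (auto simp: f_def)
  obtain G L where G: "G \<le> F" "G \<noteq> bot" and L0: "\<And>g. ((\<lambda>n. f n g) \<longlongrightarrow> L g) G"
    using bounded_functions_cluster_point[of F f "\<lambda>g. LINT x|M. \<bar>g x\<bar>", OF F fbd] by blast
  have L: "((\<lambda>n. LINT x|M. \<Phi> n x * g x) \<longlongrightarrow> L g) G" if "integrable M g" for g
    using L0[of g] that by (simp add: f_def)
  have Labs: "\<bar>L g\<bar> \<le> (LINT x|M. \<bar>g x\<bar>)" if "integrable M g" for g
    by (rule tendsto_upperbound[OF tendsto_rabs[OF L[OF that]]])
      (use bnd[OF that] G in auto)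
  have Ladd: "L (\<lambda>x. g x + g' x) = L g + L g'" if "integrable M g" "integrable M g'" for g g'
  proof (rule tendsto_unique[OF G(2) L])
    show "integrable M (\<lambda>x. g x + g' x)" using that by simp
    show "((\<lambda>n. LINT x|M. \<Phi> n x * (g x + g' x)) \<longlongrightarrow> L g + L g') G"
      using tendsto_add[OF L[OF that(1)] L[OF that(2)]] int that
      by (simp add: distrib_left)
  qed
  have Lscale: "L (\<lambda>x. g x * c) = L g * c" if "integrable M g" for g c
  proof (rule tendsto_unique[OF G(2) L])
    show "integrable M (\<lambda>x. g x * c)" using that by simp
    show "((\<lambda>n. LINT x|M. \<Phi> n x * (g x * c)) \<longlongrightarrow> L g * c) G"
      using tendsto_mult_right[OF L[OF that], of c]
      by (simp add: mult.assoc[symmetric])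
  qed
  have indint: "integrable M (indicator B :: 'a \<Rightarrow> real)" if "B \<in> sets M" for B
    using that by (simp add: less_top[symmetric])
  define \<nu> where "\<nu> = (\<lambda>B. L (indicator B))"
  have nu_nn: "0 \<le> \<nu> B" if "B \<in> sets M" for B
    unfolding \<nu>_def by (rule tendsto_lowerbound[OF L[OF indint[OF that]]])
      (use bd G in \<open>auto intro!: always_eventually integral_nonneg_AE\<close>)
  have nu_le: "\<nu> B \<le> measure M B" if "B \<in> sets M" for B
    using Labs[OF indint[OF that]] that by (simp add: \<nu>_def)
  have nu_add: "\<nu> (B \<union> C) = \<nu> B + \<nu> C" if "B \<in> sets M" "C \<in> sets M" "B \<inter> C = {}" for B C
  proof -
    have "indicator (B \<union> C) = (\<lambda>x. indicator B x + indicator C x :: real)"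
      using that(3) by (auto simp: indicator_def fun_eq_iff)
    then show ?thesis using Ladd[OF indint indint] that by (simp add: \<nu>_def)
  qed
  define N where "N = measure_of (space M) (sets M) (\<lambda>B. ennreal (\<nu> B))"
  have sN[simp]: "sets N = sets M" "space N = space M" by (simp_all add: N_def)
  have "\<nu> {} = 0" using nu_nn[of "{}"] nu_le[of "{}"] by simp
  have eN: "emeasure N B = ennreal (\<nu> B)" if "B \<in> sets M" for B
  proof (rule emeasure_measure_of[OF N_def])
    show "positive (sets N) (\<lambda>B. ennreal (\<nu> B))"
      using \<open>\<nu> {} = 0\<close> by (simp add: positive_def)
    \<comment> \<open>Finite additivity is inherited from \<open>L\<close>; the domination
      \<open>\<nu> B \<le> measure M B\<close> supplies continuity at the empty set, which upgrades
      it.\<close>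
    have "countably_additive (sets M) (\<lambda>B. ennreal (\<nu> B))"
    proof (rule sets.empty_continuous_imp_countably_additive)
      show "positive (sets M) (\<lambda>B. ennreal (\<nu> B))"
        using \<open>\<nu> {} = 0\<close> by (simp add: positive_def)
      show "additive (sets M) (\<lambda>B. ennreal (\<nu> B))"
        using nu_add nu_nn by (auto simp: additive_def ennreal_plus[symmetric] simp del: ennreal_plus)
      fix B :: "nat \<Rightarrow> 'a set" assume B: "range B \<subseteq> sets M" "decseq B" "(\<Inter>i. B i) = {}"
      have "(\<lambda>i. measure M (B i)) \<longlonglongrightarrow> measure M (\<Inter>i. B i)"
        using B by (intro finite_Lim_measure_decseq) auto
      then have m0: "(\<lambda>i. measure M (B i)) \<longlonglongrightarrow> 0" using B(3) by simp
      have "(\<lambda>i. \<nu> (B i)) \<longlonglongrightarrow> 0"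
      proof (rule tendsto_sandwich[OF _ _ tendsto_const m0])
        show "eventually (\<lambda>i. 0 \<le> \<nu> (B i)) sequentially"
          using B nu_nn by (intro always_eventually) auto
        show "eventually (\<lambda>i. \<nu> (B i) \<le> measure M (B i)) sequentially"
          using B nu_le by (intro always_eventually) auto
      qed
      then show "(\<lambda>i. ennreal (\<nu> (B i))) \<longlonglongrightarrow> 0"
        using tendsto_ennrealI by fastforce
    qed auto
    then show "countably_additive (sets N) (\<lambda>B. ennreal (\<nu> B))" by simp
  qed (use that sets.sets_into_space in auto)
  have ac: "absolutely_continuous M N"
    unfolding absolutely_continuous_def
  proof
    fix B assume "B \<in> null_sets M"
    then have "B \<in> sets M" "measure M B = 0" by (auto simp: measure_def)
    then show "B \<in> null_sets N" using nu_nn[of B] nu_le[of B] eN[of B] by (auto intro!: null_setsI)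
  qed
  have finN: "finite_measure N" by (rule finite_measureI) (simp add: eN)
  obtain k where k: "k \<in> borel_measurable M"
    "AE x in M. RN_deriv M N x = ennreal (k x)" "\<And>x. 0 \<le> k x"
    using real_RN_deriv[OF finN ac] sN by metis
  have [measurable]: "k \<in> borel_measurable M" by (rule k)
  have nuk: "ennreal (\<nu> B) = (\<integral>\<^sup>+x\<in>B. ennreal (k x) \<partial>M)" if "B \<in> sets M" for B
  proof -
    have "ennreal (\<nu> B) = emeasure (density M (RN_deriv M N)) B"
      using density_RN_deriv[OF ac] sN eN that by simp
    also have "\<dots> = (\<integral>\<^sup>+x\<in>B. ennreal (k x) \<partial>M)"
      using that k(2) by (subst emeasure_density) (auto intro!: nn_integral_cong_AE)
    finally show ?thesis .
  qed
  have ki: "integrable M k"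
  proof (rule integrableI_nonneg)
    have "(\<integral>\<^sup>+x. ennreal (k x) \<partial>M) = ennreal (\<nu> (space M))"
      by (subst nuk) (auto intro!: nn_integral_cong simp: indicator_def)
    then show "(\<integral>\<^sup>+x. ennreal (k x) \<partial>M) < \<infinity>" by simp
  qed (auto simp: k)
  have nuk': "(LINT x|M. indicator B x * k x) = \<nu> B" if B: "B \<in> sets M" for B
  proof -
    have "ennreal (\<nu> B) = (\<integral>\<^sup>+x. ennreal (indicator B x * k x) \<partial>M)"
      unfolding nuk[OF B] by (auto intro!: nn_integral_cong simp: indicator_def)
    also have "\<dots> = ennreal (LINT x|M. indicator B x * k x)"
      using integrable_mult_indicator[OF B ki] k(3) by (intro nn_integral_eq_integral) auto
    finally show ?thesis using nu_nn[OF B] k(3) by (simp add: integral_nonneg_AE)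
  qed
  have kle: "AE x in M. k x \<le> 1"
    by (rule AE_le_1_of_integral_le[OF ki]) (simp add: nuk' nu_le)
  \<comment> \<open>Truncation changes \<open>k\<close> only on a null set and turns the almost
    everywhere bound into a pointwise one.\<close>
  define h where "h = (\<lambda>x. min 1 (k x))"
  have [measurable]: "h \<in> borel_measurable M" unfolding h_def by measurable
  have hk: "AE x in M. h x = k x" using kle by eventually_elim (simp add: h_def)
  have hb: "0 \<le> h x" "h x \<le> 1" for x using k(3) by (auto simp: h_def)
  have hint: "integrable M (\<lambda>x. h x * g x)" if "integrable M g" for g
    using that by (rule Bochner_Integration.integrable_bound)
      (use that hb in \<open>auto simp: abs_mult intro!: mult_left_le_one_le\<close>)
  have rep: "L g = (LINT x|M. h x * g x)" if "integrable M g" for g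
    using that
  proof (induction rule: integrable_induct)
    case (base B c)
    have "L (\<lambda>x. indicator B x * c) = \<nu> B * c"
      using Lscale[OF indint[OF base(1)]] by (simp add: \<nu>_def)
    also have "\<dots> = (LINT x|M. indicator B x * k x) * c" by (simp add: nuk'[OF base(1)])
    also have "(LINT x|M. indicator B x * k x) = (LINT x|M. h x * indicator B x)"
      by (rule integral_cong_AE) (use hk base(1) in auto)
    also have "\<dots> * c = (LINT x|M. h x * (indicator B x * c))"
      by (simp add: mult.assoc[symmetric])
    finally show ?case by simp
  next
    case (add f g)
    then show ?case using Ladd[of f g] hint by (simp add: distrib_left)
  next
    \<comment> \<open>The domination by \<open>2 * \<bar>f x\<bar>\<close> makes \<open>s\<close>
      converge to \<open>f\<close> in L_1, and \<open>Labs\<close> makes \<open>L\<close> continuous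
      there. The factor 3 below is 2 + 1 from the triangle inequality.\<close>
    case (lim f s)
    have fi: "integrable M (\<lambda>x. 2 * \<bar>f x\<bar>)" using lim by auto
    have d0: "(\<lambda>i. LINT x|M. \<bar>s i x - f x\<bar>) \<longlonglongrightarrow> (LINT x|M. 0)"
    proof (rule integral_dominated_convergence[where w="\<lambda>x. 3 * \<bar>f x\<bar>"])
      show "AE x in M. (\<lambda>i. \<bar>s i x - f x\<bar>) \<longlonglongrightarrow> 0"
        using lim.hyps(2) by (intro AE_I2 tendsto_rabs_zero LIM_zero)
      show "AE x in M. norm \<bar>s i x - f x\<bar> \<le> 3 * \<bar>f x\<bar>" for i
        using lim.hyps(3)[of _ i] by (intro AE_I2) fastforce
    qed (use lim in auto)
    have "(\<lambda>i. L (s i)) \<longlonglongrightarrow> L f"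
    proof (rule LIM_zero_cancel, rule tendsto_rabs_zero_cancel, rule tendsto_sandwich[OF _ _ tendsto_const])
      show "(\<lambda>i. LINT x|M. \<bar>s i x - f x\<bar>) \<longlonglongrightarrow> 0" using d0 by simp
      have "L (s i) - L f = L (\<lambda>x. s i x - f x)" for i
        using Ladd[of "\<lambda>x. s i x - f x" f] lim by simp
      then show "\<forall>\<^sub>F i in sequentially. \<bar>L (s i) - L f\<bar> \<le> (LINT x|M. \<bar>s i x - f x\<bar>)"
        using Labs lim by (intro always_eventually) auto
    qed auto
    moreover have "(\<lambda>i. LINT x|M. h x * s i x) \<longlonglongrightarrow> (LINT x|M. h x * f x)"
    proof (rule integral_dominated_convergence[OF _ _ fi])
      show "AE x in M. (\<lambda>i. h x * s i x) \<longlonglongrightarrow> h x * f x"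
        using lim.hyps(2) by (intro AE_I2 tendsto_mult_left)
      show "AE x in M. norm (h x * s i x) \<le> 2 * \<bar>f x\<bar>" for i
        using lim.hyps(3)[of _ i] hb
        by (intro AE_I2) (auto simp: abs_mult intro: order_trans[OF mult_left_le_one_le])
    qed (use lim in auto)
    ultimately show ?case using lim.IH LIMSEQ_unique by simp
  qed
  show thesis
    by (rule that[OF G, of h]) (use hb L rep in auto)
qed


section \<open>Invariance in measure preserving ergodic systems\<close>

locale measure_preserving_system = sigma_finite_measure M for M :: "'a measure" +
  fixes T :: "'a \<Rightarrow> 'a"
  assumes preserving: "measure_preserving M T"
begin

lemma measurable_map[measurable]: "T \<in> measurable M M"
  and distr_map: "distr M M T = M"
  using preserving by (auto simp: measure_preserving_def)

lemma measurable_iterate[measurable]: "(T ^^ k) \<in> measurable M M"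
  by (induction k) auto

lemma iterate_in_space[simp]: "x \<in> space M \<Longrightarrow> (T ^^ k) x \<in> space M"
  using measurable_iterate[of k] by (auto simp: measurable_def)

lemma map_in_space[simp]: "x \<in> space M \<Longrightarrow> T x \<in> space M"
  using measurable_map by (auto simp: measurable_def)

lemma preimage_iter_sets[measurable]: "B \<in> sets M \<Longrightarrow> preimage_iter M T k B \<in> sets M"
  unfolding preimage_iter_def by measurable

lemma preimage_iter_Suc: "preimage_iter M T (Suc k) B = preimage_iter M T 1 (preimage_iter M T k B)"
  by (auto simp: preimage_iter_def funpow_swap1)

lemma emeasure_preimage_iter: "B \<in> sets M \<Longrightarrow> emeasure M (preimage_iter M T k B) = emeasure M B"
proof (induction k)
  case 0
  then show ?case using sets.sets_into_space by (auto simp: preimage_iter_def intro!: arg_cong2[where f=emeasure])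
next
  case (Suc k)
  have "emeasure M (preimage_iter M T 1 (preimage_iter M T k B))
      = emeasure (distr M M T) (preimage_iter M T k B)"
    using Suc.prems by (subst emeasure_distr) (auto simp: preimage_iter_def)
  also have "\<dots> = emeasure M B" using Suc by (simp add: distr_map)
  finally show ?case using preimage_iter_Suc by metis
qed

lemma AE_iterate:
  assumes "AE x in M. P x"
  shows "AE x in M. P ((T ^^ k) x)"
proof -
  from assms obtain N where N: "N \<in> null_sets M" "{x\<in>space M. \<not> P x} \<subseteq> N"
    by (auto simp: eventually_ae_filter)
  have "preimage_iter M T k N \<in> null_sets M"
    using N(1) emeasure_preimage_iter[of N k] by (auto simp: null_setsD1 intro!: null_setsI)
  then show ?thesis
    by (rule AE_I') (use N(2) iterate_in_space[of _ k] in \<open>auto simp: preimage_iter_def simp del: iterate_in_space\<close>)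
qed

text \<open>Whether an orbit enters \<open>B\<close> infinitely often is unchanged by one step, so
  this set is strictly invariant, as the definition of \<open>ergodic\<close> demands. It serves
  twice: to repair almost invariant sets, and for the recurrence to \<open>A\<close>.\<close>

definition recurrence_set :: "'a set \<Rightarrow> 'a set" where
  "recurrence_set B = {x\<in>space M. \<forall>n. \<exists>k\<ge>n. (T ^^ k) x \<in> B}"

lemma recurrence_set_sets[measurable]: "B \<in> sets M \<Longrightarrow> recurrence_set B \<in> sets M"
proof -
  assume B: "B \<in> sets M"
  have "recurrence_set B = (\<Inter>n. \<Union>k\<in>{n..}. preimage_iter M T k B)"
    by (auto simp: recurrence_set_def preimage_iter_def Bex_def)
  then show ?thesis
    using preimage_iter_sets[OF B] by (auto intro!: sets.countable_INT sets.countable_UN)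
qed

lemma recurrence_set_invariant: "preimage_iter M T 1 (recurrence_set B) = recurrence_set B"
proof -
  have shift: "(T ^^ k) (T x) = (T ^^ Suc k) x" for k x by (simp add: funpow_swap1)
  have "(\<forall>n. \<exists>k\<ge>n. (T ^^ k) (T x) \<in> B) \<longleftrightarrow> (\<forall>n. \<exists>k\<ge>n. (T ^^ k) x \<in> B)" for x
    unfolding shift
  proof (intro iffI allI)
    fix n assume "\<forall>n. \<exists>k\<ge>n. (T ^^ Suc k) x \<in> B"
    then obtain k where "k \<ge> n" "(T ^^ Suc k) x \<in> B" by blast
    then show "\<exists>k\<ge>n. (T ^^ k) x \<in> B" by (intro exI[of _ "Suc k"]) auto
  next
    fix n assume "\<forall>n. \<exists>k\<ge>n. (T ^^ k) x \<in> B"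
    then obtain k where k: "k \<ge> Suc n" "(T ^^ k) x \<in> B" by blast
    then have "k - 1 \<ge> n" "(T ^^ Suc (k - 1)) x \<in> B" by auto
    then show "\<exists>k\<ge>n. (T ^^ Suc k) x \<in> B" by blast
  qed
  then show ?thesis by (auto simp: preimage_iter_def recurrence_set_def)
qed

text \<open>For almost every point, membership in \<open>B\<close> is constant along the whole
  orbit, so \<open>B\<close> differs only by a null set from the strictly invariant
  \<open>recurrence_set B\<close>, to which \<open>ergodic\<close> applies.\<close>

lemma ergodic_AE_invariant_set:
  assumes erg: "ergodic M T" and B[measurable]: "B \<in> sets M"
    and inv: "AE x in M. T x \<in> B \<longleftrightarrow> x \<in> B"
  shows "(AE x in M. x \<in> B) \<or> (AE x in M. x \<notin> B)"
proof -
  have "AE x in M. \<forall>k. (T ^^ Suc k) x \<in> B \<longleftrightarrow> (T ^^ k) x \<in> B"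
    using AE_iterate[OF inv] by (simp add: AE_all_countable)
  then have eq: "AE x in M. x \<in> recurrence_set B \<longleftrightarrow> x \<in> B"
    using AE_space
  proof eventually_elim
    case (elim x)
    have "(T ^^ k) x \<in> B \<longleftrightarrow> x \<in> B" for k
      using elim(1) by (induction k) auto
    then show ?case using elim(2) by (auto simp: recurrence_set_def)
  qed
  from erg recurrence_set_invariant[of B] recurrence_set_sets[OF B]
  consider "recurrence_set B \<in> null_sets M" | "space M - recurrence_set B \<in> null_sets M"
    unfolding ergodic_def by blast
  then show ?thesis
  proof cases
    case 1
    then have "AE x in M. x \<notin> recurrence_set B" by (rule AE_not_in)
    with eq have "AE x in M. x \<notin> B" by eventually_elim simp
    then show ?thesis ..
  next
    case 2
    then have "AE x in M. x \<notin> space M - recurrence_set B" by (rule AE_not_in)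
    then have "AE x in M. x \<in> recurrence_set B" using AE_space by eventually_elim auto
    with eq have "AE x in M. x \<in> B" by eventually_elim simp
    then show ?thesis ..
  qed
qed

text \<open>Any weak-star cluster point of the sequence is $T$-invariant, hence constant by
  ergodicity, so it does not distinguish between probability densities.\<close>

lemma ergodic_asymptotic_invariance:
  fixes \<Phi> :: "nat \<Rightarrow> 'a \<Rightarrow> real"
  assumes erg: "ergodic M T"
    and meas[measurable]: "\<And>n. \<Phi> n \<in> borel_measurable M"
    and bd: "\<And>n x. 0 \<le> \<Phi> n x" "\<And>n x. \<Phi> n x \<le> 1"
    and inv: "\<And>n x. x \<in> space M \<Longrightarrow> \<bar>\<Phi> n (T x) - \<Phi> n x\<bar> \<le> c n" and c: "c \<longlonglongrightarrow> 0"
    and N1: "N1 \<in> ac_probs M" and N2: "N2 \<in> ac_probs M"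
  shows "(\<lambda>n. (LINT x|N1. \<Phi> n x) - (LINT x|N2. \<Phi> n x)) \<longlonglongrightarrow> 0"
proof (rule ccontr)
  define d where "d = (\<lambda>n. (LINT x|N1. \<Phi> n x) - (LINT x|N2. \<Phi> n x))"
  assume "\<not> (\<lambda>n. (LINT x|N1. \<Phi> n x) - (LINT x|N2. \<Phi> n x)) \<longlonglongrightarrow> 0"
  then have "\<not> (\<forall>e>0. \<forall>\<^sub>F n in sequentially. \<bar>d n\<bar> < e)"
    unfolding d_def[symmetric] tendsto_iff dist_real_def diff_0_right .
  then obtain e where e: "e > 0" "\<not> (\<forall>\<^sub>F n in sequentially. \<bar>d n\<bar> < e)"
    by blast
  \<comment> \<open>If convergence fails, infinitely many indices keep a gap of at least
    \<open>e\<close>. A cluster point taken along this filter inherits the gap, which gives the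
    contradiction at the end.\<close>
  define F where "F = inf sequentially (principal {n. \<bar>d n\<bar> \<ge> e})"
  have F: "F \<noteq> bot"
  proof
    assume "F = bot"
    then have "eventually (\<lambda>_. False) F" by simp
    then have "eventually (\<lambda>n. \<bar>d n\<bar> < e) sequentially"
      unfolding F_def eventually_inf_principal by (rule eventually_mono) (simp add: not_le)
    with e(2) show False by simp
  qed
  \<comment> \<open>The compactness lemma works over a finite measure; a strictly positive
    integrable \<open>p\<close> turns \<open>M\<close> into a finite \<open>P\<close> with the same
    null sets.\<close>
  obtain p where [measurable]: "p \<in> borel_measurable M" and pfin: "integral\<^sup>N M p \<noteq> \<infinity>"
    and ppos: "\<And>x. x \<in> space M \<Longrightarrow> 0 < p x"
    using Ex_finite_integrable_function by metis
  define P where "P = density M p"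
  have sP[measurable_cong, simp]: "sets P = sets M" and spP[simp]: "space P = space M"
    by (auto simp: P_def)
  interpret P: finite_measure P
  proof (rule finite_measureI)
    have "emeasure P (space P) = integral\<^sup>N M p"
      unfolding P_def by (simp add: emeasure_density cong: nn_integral_cong)
    then show "emeasure P (space P) \<noteq> \<infinity>" using pfin by simp
  qed
  have AEP: "(AE x in P. Q x) \<longleftrightarrow> (AE x in M. Q x)" for Q
  proof -
    have "(AE x in P. Q x) \<longleftrightarrow> (AE x in M. 0 < p x \<longrightarrow> Q x)"
      unfolding P_def by (subst AE_density) auto
    also have "\<dots> \<longleftrightarrow> (AE x in M. Q x)"
      using ppos by (intro AE_cong) auto
    finally show ?thesis .
  qed
  have nullP: "null_sets P = null_sets M"
  proof (intro set_eqI)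
    fix B
    show "B \<in> null_sets P \<longleftrightarrow> B \<in> null_sets M"
    proof (cases "B \<in> sets M")
      case True
      then show ?thesis using AEP[of "\<lambda>x. x \<notin> B"] AE_iff_null_sets[of B M] AE_iff_null_sets[of B P]
        by simp
    qed auto
  qed
  have measP: "\<Phi> n \<in> borel_measurable P" for n by simp
  obtain G h where G: "G \<le> F" "G \<noteq> bot" and [measurable]: "h \<in> borel_measurable P"
    and hb: "\<And>x. 0 \<le> h x" "\<And>x. h x \<le> 1"
    and lim: "\<And>g. integrable P g \<Longrightarrow> ((\<lambda>n. LINT x|P. \<Phi> n x * g x) \<longlongrightarrow> (LINT x|P. h x * g x)) G"
    using P.weak_star_cluster_point[of F \<Phi>, OF F _ bd] measP by blast
  have [measurable]: "h \<in> borel_measurable M" using \<open>h \<in> borel_measurable P\<close> by simp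
  have Gseq: "G \<le> sequentially" using G(1) by (simp add: F_def)
  have limN: "((\<lambda>n. LINT x|N. \<Phi> n x) \<longlongrightarrow> (LINT x|N. h x)) G"
    if N: "finite_measure N" "sets N = sets M" "absolutely_continuous M N" for N
  proof -
    have ac: "absolutely_continuous P N" using N(3) by (simp add: absolutely_continuous_def nullP)
    have sNP: "sets N = sets P" using N(2) by simp
    obtain g where g: "g \<in> borel_measurable P"
      "AE x in P. RN_deriv P N x = ennreal (g x)" "\<And>x. 0 \<le> g x"
      using P.real_RN_deriv[OF N(1) ac sNP] by metis
    have [measurable]: "g \<in> borel_measurable P" by (rule g)
    have Nd: "N = density P (\<lambda>x. ennreal (g x))"
      using P.density_RN_deriv[OF ac sNP] density_cong[of "RN_deriv P N" P "\<lambda>x. ennreal (g x)"] g(2)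
      by simp
    interpret N: finite_measure N by fact
    have "integrable N (\<lambda>x. 1::real)" by simp
    then have gi: "integrable P g"
      unfolding Nd by (subst (asm) integrable_density) (use g in auto)
    have "(LINT x|N. u x) = (LINT x|P. u x * g x)" if [measurable]: "u \<in> borel_measurable P"
      for u :: "'a \<Rightarrow> real"
      unfolding Nd by (subst integral_density) (use g in \<open>auto simp: mult.commute\<close>)
    then show ?thesis using lim[OF gi] by simp
  qed
  \<comment> \<open>The image measure of \<open>N\<close> under \<open>T\<close> is again absolutely
    continuous, so testing with it replaces \<open>\<Phi> n x\<close> by
    \<open>\<Phi> n (T x)\<close>, which is within \<open>c n\<close> of it.\<close>
  have hT: "(LINT x|N. h (T x)) = (LINT x|N. h x)"
    if N: "finite_measure N" "sets N = sets M" "absolutely_continuous M N" for N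
  proof -
    interpret N: finite_measure N by fact
    have [measurable_cong]: "sets N = sets M" by fact
    have spN: "space N = space M" using N(2) by (rule sets_eq_imp_space_eq)
    have [measurable]: "T \<in> measurable N M" by simp
    define N' where "N' = distr N M T"
    have N': "finite_measure N'" "sets N' = sets M"
      unfolding N'_def by (auto intro!: N.finite_measure_distr)
    have acN': "absolutely_continuous M N'"
      unfolding absolutely_continuous_def
    proof
      fix B assume B: "B \<in> null_sets M"
      then have "preimage_iter M T 1 B \<in> null_sets M"
        using emeasure_preimage_iter[of B 1] by (auto simp: null_setsD1 intro!: null_setsI)
      then have "preimage_iter M T 1 B \<in> null_sets N"
        using N(3) by (auto simp: absolutely_continuous_def)
      then show "B \<in> null_sets N'" using B unfolding N'_def
        by (intro null_setsI) (auto simp: emeasure_distr preimage_iter_def spN null_setsD1 null_setsD2)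
    qed
    have int: "integrable N u" if [measurable]: "u \<in> borel_measurable N" and "\<And>x. 0 \<le> u x" "\<And>x. u x \<le> 1"
      for u :: "'a \<Rightarrow> real"
      using that by (intro N.integrable_const_bound[of _ 1]) auto
    have "((\<lambda>n. LINT x|N. \<Phi> n (T x)) \<longlongrightarrow> (LINT x|N. h (T x))) G"
      using limN[OF N' acN'] unfolding N'_def by (simp add: integral_distr)
    moreover have "((\<lambda>n. (LINT x|N. \<Phi> n (T x)) - (LINT x|N. \<Phi> n x)) \<longlongrightarrow> 0) G"
    proof (rule tendsto_rabs_zero_cancel, rule tendsto_sandwich[OF _ _ tendsto_const])
      have "\<bar>(LINT x|N. \<Phi> n (T x)) - (LINT x|N. \<Phi> n x)\<bar> \<le> c n * measure N (space N)" for n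
      proof -
        have "(LINT x|N. \<Phi> n (T x)) - (LINT x|N. \<Phi> n x) = (LINT x|N. \<Phi> n (T x) - \<Phi> n x)"
          by (subst Bochner_Integration.integral_diff) (auto intro!: int simp: bd)
        also have "\<bar>\<dots>\<bar> \<le> (LINT x|N. \<bar>\<Phi> n (T x) - \<Phi> n x\<bar>)" by (rule integral_abs_bound)
        also have "\<dots> \<le> (LINT x|N. c n)"
          by (rule integral_mono)
            (auto intro!: integrable_abs Bochner_Integration.integrable_diff int simp: bd inv spN)
        finally show ?thesis by (simp add: mult.commute)
      qed
      then show "\<forall>\<^sub>F n in G. \<bar>(LINT x|N. \<Phi> n (T x)) - (LINT x|N. \<Phi> n x)\<bar> \<le> c n * measure N (space N)"
        by simp
      show "((\<lambda>n. c n * measure N (space N)) \<longlongrightarrow> 0) G"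
        by (rule tendsto_mono[OF Gseq]) (rule tendsto_mult_left_zero[OF c])
    qed auto
    ultimately have "((\<lambda>n. LINT x|N. \<Phi> n x) \<longlongrightarrow> (LINT x|N. h (T x))) G"
      using tendsto_diff by fastforce
    then show ?thesis using limN[OF N] tendsto_unique[OF G(2)] by blast
  qed
  have acPP: "absolutely_continuous M (density P (indicator D))" if "D \<in> sets M" for D
    unfolding absolutely_continuous_def nullP[symmetric]
    using that by (metis absolutely_continuousI_density absolutely_continuous_def borel_measurable_indicator sP)
  \<comment> \<open>Restricting \<open>P\<close> to the set where \<open>k (T x) < k x\<close> gives
    an integrand that is positive there and has integral zero. Using both \<open>h\<close> and its
    negative yields equality almost everywhere.\<close>
  have le: "AE x in P. \<not> k (T x) < k x" if k: "k = h \<or> k = (\<lambda>x. - h x)" for k :: "'a \<Rightarrow> real"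
  proof -
    have [measurable]: "k \<in> borel_measurable M" using k by auto
    define D where "D = {x\<in>space M. k (T x) < k x}"
    have D[measurable]: "D \<in> sets M" unfolding D_def by measurable
    define N where "N = density P (indicator D)"
    have sN: "sets N = sets M" by (simp add: N_def)
    have "emeasure N (space N) = (\<integral>\<^sup>+x. indicator D x * indicator (space M) x \<partial>P)"
      unfolding N_def by (simp add: emeasure_density)
    also have "\<dots> = (\<integral>\<^sup>+x. indicator D x \<partial>P)" by (rule nn_integral_cong) simp
    also have "\<dots> = emeasure P D" by simp
    finally have "emeasure N (space N) \<noteq> \<infinity>" by (simp add: P.emeasure_eq_measure)
    then have N: "finite_measure N" "sets N = sets M"
      using sN by (auto intro!: finite_measureI)
    have kb: "\<bar>k x\<bar> \<le> 1" for x using k hb[of x] by auto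
    have int: "integrable P (\<lambda>x. indicator D x * u x)" if [measurable]: "u \<in> borel_measurable M"
      and "\<And>x. \<bar>u x\<bar> \<le> 1" for u :: "'a \<Rightarrow> real"
      by (rule P.integrable_const_bound[of _ 1]) (use that in \<open>auto simp: indicator_def\<close>)
    have tr: "(LINT x|N. u x) = (LINT x|P. indicator D x * u x)" if [measurable]: "u \<in> borel_measurable M"
      for u :: "'a \<Rightarrow> real"
    proof -
      have "N = density P (\<lambda>x. ennreal (indicator D x))"
        unfolding N_def by (intro density_cong) (auto simp: indicator_def)
      then show ?thesis by (simp add: integral_density)
    qed
    have "(LINT x|N. k (T x)) = (LINT x|N. k x)"
      using hT[OF N acPP[OF D, folded N_def]] k by auto
    then have z: "(LINT x|P. indicator D x * (k x - k (T x))) = 0"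
      using int[of k] int[of "\<lambda>x. k (T x)"] kb by (simp add: tr right_diff_distrib)
    have "AE x in P. indicator D x * (k x - k (T x)) = 0"
      using z by (subst (asm) integral_nonneg_eq_0_iff_AE)
        (use int[of k] int[of "\<lambda>x. k (T x)"] kb in \<open>auto simp: right_diff_distrib D_def indicator_def\<close>)
    then show ?thesis using AE_space
      by eventually_elim (auto simp: D_def indicator_def split: if_splits)
  qed
  have "AE x in P. h (T x) = h x"
    using le[of h] le[of "\<lambda>x. - h x"] by auto
  then have hinv: "AE x in M. h (T x) = h x" by (simp add: AEP)
  interpret N1: prob_space N1 using N1 by (simp add: ac_probs_def)
  have N1s: "sets N1 = sets M" "absolutely_continuous M N1" using N1 by (auto simp: ac_probs_def)
  have N2s: "prob_space N2" "sets N2 = sets M" "absolutely_continuous M N2"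
    using N2 by (auto simp: ac_probs_def)
  have [measurable_cong]: "sets N1 = sets M" "sets N2 = sets M" by fact+
  have AE1: "AE x in N. Q x" if "AE x in M. Q x" "sets N = sets M" "absolutely_continuous M N" for Q N
    using that absolutely_continuous_AE[of N M Q] by auto
  define C where "C = (LINT x|N1. h x)"
  have hi: "integrable N1 h"
    using hb by (intro N1.integrable_const_bound[of _ 1]) auto
  \<comment> \<open>By ergodicity the sets \<open>h < C\<close> and \<open>C < h\<close> are null or
    full, and neither can be full, because \<open>C\<close> is the \<open>N1\<close>-mean of
    \<open>h\<close>.\<close>
  have hC: "AE x in M. h x = C"
  proof -
    have "\<not> (AE x in M. h x < C)"
    proof
      assume "AE x in M. h x < C"
      then have "AE x in N1. h x < C" using AE1 N1s by auto
      then have "(LINT x|N1. h x) < (LINT x|N1. C)"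
        using hi N1.emeasure_space_1 by (intro N1.integral_less_AE_space) auto
      then show False by (simp add: C_def N1.prob_space)
    qed
    moreover have "\<not> (AE x in M. C < h x)"
    proof
      assume "AE x in M. C < h x"
      then have "AE x in N1. C < h x" using AE1 N1s by auto
      then have "(LINT x|N1. C) < (LINT x|N1. h x)"
        using hi N1.emeasure_space_1 by (intro N1.integral_less_AE_space) auto
      then show False by (simp add: C_def N1.prob_space)
    qed
    moreover have "(AE x in M. x \<in> {x\<in>space M. h x < C}) \<or> (AE x in M. x \<notin> {x\<in>space M. h x < C})"
    proof (rule ergodic_AE_invariant_set[OF erg])
      show "AE x in M. T x \<in> {x\<in>space M. h x < C} \<longleftrightarrow> x \<in> {x\<in>space M. h x < C}"
        using hinv AE_space by eventually_elim auto
    qed measurable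
    moreover have "(AE x in M. x \<in> {x\<in>space M. C < h x}) \<or> (AE x in M. x \<notin> {x\<in>space M. C < h x})"
    proof (rule ergodic_AE_invariant_set[OF erg])
      show "AE x in M. T x \<in> {x\<in>space M. C < h x} \<longleftrightarrow> x \<in> {x\<in>space M. C < h x}"
        using hinv AE_space by eventually_elim auto
    qed measurable
    moreover have "(AE x in M. h x < C)" if "AE x in M. x \<in> {x\<in>space M. h x < C}"
      using that by eventually_elim simp
    moreover have "(AE x in M. C < h x)" if "AE x in M. x \<in> {x\<in>space M. C < h x}"
      using that by eventually_elim simp
    ultimately have "AE x in M. x \<notin> {x\<in>space M. h x < C}" "AE x in M. x \<notin> {x\<in>space M. C < h x}"
      by blast+
    then show ?thesis using AE_space by eventually_elim auto
  qed
  have "(LINT x|N2. h x) = (LINT x|N2. C)"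
    by (rule integral_cong_AE) (use AE1[OF hC N2s(2,3)] in auto)
  also have "\<dots> = C" using N2s(1) by (simp add: prob_space.prob_space)
  finally have "(d \<longlongrightarrow> 0) G"
    using tendsto_diff[OF limN[of N1] limN[of N2]] N1s N2s N1.finite_measure_axioms
    by (simp add: C_def d_def prob_space.finite_measure)
  then have "eventually (\<lambda>n. \<bar>d n\<bar> < e) G" using e(1) by (auto simp: tendsto_iff)
  moreover have "eventually (\<lambda>n. \<bar>d n\<bar> \<ge> e) G"
    by (rule filter_leD[OF G(1)]) (simp add: F_def eventually_inf_principal)
  ultimately have "eventually (\<lambda>_. False) G" by eventually_elim auto
  with G(2) show False by simp
qed

end

section \<open>Slowly varying tails\<close>


locale doubling_tail_sums =
  fixes q :: "nat \<Rightarrow> real"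
  assumes q_decseq: "decseq q" and q_nonneg: "\<And>n. 0 \<le> q n" and q_0_pos: "0 < q 0"
    and doubling_sums: "(\<lambda>n. (\<Sum>k\<le>2 * n. q k) / (\<Sum>k\<le>n. q k)) \<longlonglongrightarrow> 2"
begin

definition W :: "nat \<Rightarrow> real" where
  "W n = (\<Sum>k\<le>n. q k)"

definition w :: "nat \<Rightarrow> real" where
  "w n = W n / real n"

lemma doubling: "(\<lambda>n. W (2 * n) / W n) \<longlonglongrightarrow> 2"
  using doubling_sums by (simp add: W_def)

lemma q_mono: "m \<le> n \<Longrightarrow> q n \<le> q m"
  using q_decseq by (auto simp: decseq_def)

lemma W_Suc: "W (Suc n) = W n + q (Suc n)"
  by (simp add: W_def)

lemma W_pos: "0 < W n"
proof (induction n)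
  case (Suc n)
  then show ?case using q_nonneg[of "Suc n"] by (simp add: W_Suc)
qed (simp add: W_def q_0_pos)

lemma W_add_le: "W (m + n) \<le> W m + real n * q m"
proof (induction n)
  case (Suc n)
  then show ?case using q_mono[of m "Suc (m + n)"] by (simp add: W_Suc algebra_simps)
qed simp

lemma W_add_ge: "W m + real n * q (m + n) \<le> W (m + n)"
proof (induction n)
  case (Suc n)
  have "real n * q (Suc (m + n)) \<le> real n * q (m + n)"
    by (intro mult_left_mono q_mono) auto
  with Suc show ?case by (simp add: W_Suc algebra_simps)
qed simp

lemma w_pos: "1 \<le> n \<Longrightarrow> 0 < w n"
  using W_pos[of n] by (simp add: w_def)

text \<open>\<open>W n\<close> has \<open>n + 1\<close> terms, each at least \<open>q n\<close>,
  hence \<open>n * q n \<le> W n\<close>; so appending the even smaller \<open>q (Suc n)\<close>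
  cannot raise the quotient.\<close>

lemma w_antimono:
  assumes "1 \<le> m" "m \<le> n"
  shows "w n \<le> w m"
  using assms(2)
proof (induction rule: dec_induct)
  case (step n)
  have "real n * q (Suc n) \<le> W n"
    using W_add_ge[of 0 n] q_mono[of n "Suc n"] q_0_pos mult_left_mono[of "q (Suc n)" "q n" "real n"]
    by (simp add: W_def)
  then have "W (Suc n) / real (Suc n) \<le> W n / real n"
    using step assms(1) by (simp add: W_Suc field_simps)
  with step show ?case by (simp add: w_def)
qed simp

lemma w_doubling: "(\<lambda>n. w (2 * n) / w n) \<longlonglongrightarrow> 1"
proof -
  have "(\<lambda>n. W (2 * n) / W n / 2) \<longlonglongrightarrow> 2 / 2" by (intro tendsto_divide doubling) auto
  moreover have "\<forall>\<^sub>F n in sequentially. W (2 * n) / W n / 2 = w (2 * n) / w n"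
    using eventually_gt_at_top[of 0] by eventually_elim (simp add: w_def)
  ultimately show ?thesis by (simp add: Lim_transform_eventually)
qed

text \<open>Monotone density argument: \<open>W (2 * n) - W n\<close> is at most
  \<open>n * q n\<close>, while \<open>W n - W (n div 2)\<close> is at least
  \<open>n / 2 * q n\<close>; the doubling limit evaluates both blocks.\<close>

lemma q_asymp: "(\<lambda>n. q n / w n) \<longlonglongrightarrow> 1"
proof (rule tendsto_sandwich)
  have dh: "filterlim (\<lambda>n::nat. n div 2) at_top sequentially"
    unfolding filterlim_at_top
  proof
    fix Z show "eventually (\<lambda>n::nat. Z \<le> n div 2) sequentially"
      using eventually_ge_at_top[of "2 * Z"] by eventually_elim auto
  qed
  show "(\<lambda>n. W (2 * n) / W n - 1) \<longlonglongrightarrow> 1"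
    using tendsto_diff[OF doubling tendsto_const[of 1]] by simp
  show "eventually (\<lambda>n. W (2 * n) / W n - 1 \<le> q n / w n) sequentially"
  proof (rule always_eventually, rule allI)
    fix n
    have "W (2 * n) \<le> W n + real n * q n" using W_add_le[of n n] by (simp add: mult_2)
    then have "W (2 * n) / W n \<le> (W n + real n * q n) / W n"
      using W_pos[of n] by (intro divide_right_mono) auto
    then show "W (2 * n) / W n - 1 \<le> q n / w n"
      using W_pos[of n] by (simp add: w_def add_divide_distrib mult.commute)
  qed
  \<comment> \<open>Parity correction: for odd \<open>n\<close> halving loses one step.\<close>
  have r: "(\<lambda>n. 2 * real (n div 2) / real n) \<longlonglongrightarrow> 1"
  proof (rule tendsto_sandwich)
    show "(\<lambda>n. 1 - 1 / real n) \<longlonglongrightarrow> 1"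
      using tendsto_diff[OF tendsto_const[of 1] lim_1_over_n] by simp
    show "eventually (\<lambda>n. 1 - 1 / real n \<le> 2 * real (n div 2) / real n) sequentially"
      using eventually_gt_at_top[of 0]
    proof eventually_elim
      case (elim n)
      have "n \<le> 2 * (n div 2) + 1" by presburger
      then have "real n \<le> 2 * real (n div 2) + 1" by linarith
      then have "real n / real n \<le> (2 * real (n div 2) + 1) / real n"
        by (intro divide_right_mono) auto
      then show ?case using elim by (simp add: add_divide_distrib)
    qed
    show "eventually (\<lambda>n. 2 * real (n div 2) / real n \<le> 1) sequentially"
      using eventually_gt_at_top[of 0]
    proof eventually_elim
      case (elim n)
      have "2 * (n div 2) \<le> n" by presburger
      then have "2 * real (n div 2) \<le> real n" by linarith
      then show ?case using elim by (simp add: field_simps)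
    qed
  qed auto
  have "(\<lambda>n. W (2 * (n div 2)) / W (n div 2)) \<longlonglongrightarrow> 2"
    using filterlim_compose[OF doubling dh] .
  then have "(\<lambda>n. 2 * (1 - (2 * real (n div 2) / real n) / (W (2 * (n div 2)) / W (n div 2)))) \<longlonglongrightarrow> 2 * (1 - 1 / 2)"
    by (intro tendsto_intros r) auto
  then show "(\<lambda>n. 2 * (1 - (2 * real (n div 2) / real n) / (W (2 * (n div 2)) / W (n div 2)))) \<longlonglongrightarrow> 1"
    by simp
  show "eventually (\<lambda>n. q n / w n \<le> 2 * (1 - (2 * real (n div 2) / real n) / (W (2 * (n div 2)) / W (n div 2)))) sequentially"
    using eventually_ge_at_top[of 2]
  proof eventually_elim
    case (elim n)
    define m where "m = n div 2"
    have m: "1 \<le> m" "2 * m \<le> n" using elim by (auto simp: m_def)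
    have 1: "W m + real (n - m) * q n \<le> W n" using W_add_ge[of m "n - m"] m by simp
    have "real n / 2 \<le> real (n - m)" using m by (simp add: of_nat_diff field_simps)
    then have "real n / 2 * q n \<le> real (n - m) * q n" by (intro mult_right_mono q_nonneg)
    with 1 have 2: "real n * q n \<le> 2 * (W n - W m)" by simp
    have "q n / w n = real n * q n / W n" by (simp add: w_def)
    also have "\<dots> \<le> 2 * (W n - W m) / W n" using 2 W_pos[of n] by (intro divide_right_mono) auto
    also have "\<dots> = 2 * (1 - W m / W n)" using W_pos[of n] by (simp add: field_simps)
    finally have 3: "q n / w n \<le> 2 * (1 - W m / W n)" .
    \<comment> \<open>Doubling speaks about \<open>W (2 * m)\<close>, not \<open>W n\<close>.
      Monotonicity of \<open>w\<close> bridges the two at the price of the factor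
      \<open>2 * m / n\<close> treated in \<open>r\<close>.\<close>
    have "w n \<le> w (2 * m)" using m by (intro w_antimono) auto
    then have "W n * (2 * real m) \<le> W (2 * m) * real n"
      using m elim by (simp add: w_def field_simps)
    then have "(2 * real m / real n) / (W (2 * m) / W m) \<le> W m / W n"
      using W_pos[of n] W_pos[of m] W_pos[of "2 * m"] elim
      by (simp add: field_simps)
    with 3 show ?case by (simp add: m_def)
  qed
qed

lemma w_power_doubling: "(\<lambda>n. w (2 ^ j * n) / w n) \<longlonglongrightarrow> 1"
proof (induction j)
  case 0
  have "eventually (\<lambda>n. 1 = w (2 ^ 0 * n) / w n) sequentially"
    using eventually_ge_at_top[of 1]
  proof eventually_elim
    case (elim n)
    then show ?case using w_pos[of n] by simp
  qed
  then show ?case by (rule Lim_transform_eventually[OF tendsto_const])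
next
  case (Suc j)
  have "filterlim (\<lambda>n::nat. 2 ^ j * n) at_top sequentially"
    by (rule filterlim_at_top_mono[OF filterlim_ident]) auto
  from tendsto_mult[OF filterlim_compose[OF w_doubling this] Suc]
  have "(\<lambda>n. w (2 * (2 ^ j * n)) / w (2 ^ j * n) * (w (2 ^ j * n) / w n)) \<longlonglongrightarrow> 1" by simp
  then show ?case
  proof (rule Lim_transform_eventually)
    show "\<forall>\<^sub>F n in sequentially. w (2 * (2 ^ j * n)) / w (2 ^ j * n) * (w (2 ^ j * n) / w n)
        = w (2 ^ Suc j * n) / w n"
      using eventually_ge_at_top[of 1]
    proof eventually_elim
      case (elim n)
      then have "w (2 ^ j * n) > 0" by (intro w_pos) auto
      then show ?case by (simp add: mult.assoc)
    qed
  qed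
qed

lemma w_ratio_above:
  assumes u: "filterlim u at_top sequentially"
    and le: "eventually (\<lambda>n. u n \<le> v n) sequentially" "eventually (\<lambda>n. v n \<le> 2 ^ j * u n) sequentially"
  shows "(\<lambda>n. w (v n) / w (u n)) \<longlonglongrightarrow> 1"
proof (rule tendsto_sandwich)
  have u1: "eventually (\<lambda>n. 1 \<le> u n) sequentially" using u by (simp add: filterlim_at_top)
  show "(\<lambda>n. w (2 ^ j * u n) / w (u n)) \<longlonglongrightarrow> 1"
    using filterlim_compose[OF w_power_doubling u] .
  show "(\<lambda>n::nat. 1::real) \<longlonglongrightarrow> 1" by simp
  show "eventually (\<lambda>n. w (v n) / w (u n) \<le> 1) sequentially"
    using u1 le(1) by eventually_elim (simp add: w_antimono w_pos)
  show "eventually (\<lambda>n. w (2 ^ j * u n) / w (u n) \<le> w (v n) / w (u n)) sequentially"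
    using u1 le
  proof eventually_elim
    case (elim n)
    then show ?case using w_pos[of "u n"] by (intro divide_right_mono w_antimono) auto
  qed
qed

text \<open>Slow variation along sequences of bounded ratio. The index \<open>2 ^ i * v n\<close>
  lies above both \<open>u n\<close> and \<open>v n\<close>, so comparison from above applies to
  each, and the quotient of the two limits is the claim.\<close>

lemma w_ratio:
  assumes u: "filterlim u at_top sequentially"
    and le: "eventually (\<lambda>n. u n \<le> 2 ^ i * v n) sequentially" "eventually (\<lambda>n. v n \<le> 2 ^ j * u n) sequentially"
  shows "filterlim v at_top sequentially" "(\<lambda>n. w (v n) / w (u n)) \<longlonglongrightarrow> 1"
proof -
  show v: "filterlim v at_top sequentially"
    unfolding filterlim_at_top
  proof
    fix Z
    have "eventually (\<lambda>n. 2 ^ i * Z \<le> u n) sequentially" using u by (simp add: filterlim_at_top)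
    then show "eventually (\<lambda>n. Z \<le> v n) sequentially"
      using le(1)
    proof eventually_elim
      case (elim n)
      then have "2 ^ i * Z \<le> 2 ^ i * v n" by linarith
      then show ?case by simp
    qed
  qed
  have 1: "(\<lambda>n. w (2 ^ i * v n) / w (u n)) \<longlonglongrightarrow> 1"
  proof (rule w_ratio_above[OF u le(1)])
    show "eventually (\<lambda>n. 2 ^ i * v n \<le> 2 ^ (i + j) * u n) sequentially"
      using le(2) by eventually_elim (simp add: power_add)
  qed
  have 2: "(\<lambda>n. w (2 ^ i * v n) / w (v n)) \<longlonglongrightarrow> 1"
    using filterlim_compose[OF w_power_doubling v] .
  from tendsto_divide[OF 1 2]
  have "(\<lambda>n. (w (2 ^ i * v n) / w (u n)) / (w (2 ^ i * v n) / w (v n))) \<longlonglongrightarrow> 1" by simp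
  then show "(\<lambda>n. w (v n) / w (u n)) \<longlonglongrightarrow> 1"
  proof (rule Lim_transform_eventually)
    have "eventually (\<lambda>n. 1 \<le> v n) sequentially" using v by (simp add: filterlim_at_top)
    then show "\<forall>\<^sub>F n in sequentially. (w (2 ^ i * v n) / w (u n)) / (w (2 ^ i * v n) / w (v n)) = w (v n) / w (u n)"
    proof eventually_elim
      case (elim n)
      then have "w (2 ^ i * v n) > 0" by (intro w_pos) (simp add: Suc_le_eq)
      then show ?case by simp
    qed
  qed
qed

section \<open>Levels at which \<open>w\<close> has fallen to a given fraction\<close>

text \<open>A generalised inverse of the nonincreasing \<open>w\<close>. The clause
  \<open>1 \<le> y\<close> excludes \<open>w 0\<close>, which is 0 by the convention for
  division.\<close>

definition level :: "real \<Rightarrow> nat \<Rightarrow> nat" where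
  "level t n = (LEAST y. 1 \<le> y \<and> w y \<le> t * w n)"

context
  fixes t :: real
  assumes q_null: "q \<longlonglongrightarrow> 0" and t: "0 < t" "t < 1"
begin

lemma w_null: "w \<longlonglongrightarrow> 0"
proof -
  have "(\<lambda>n. q n / (q n / w n)) \<longlonglongrightarrow> 0 / 1" by (rule tendsto_divide[OF q_null q_asymp]) simp
  moreover have "eventually (\<lambda>n. q n / w n > 0) sequentially"
    using order_tendstoD(1)[OF q_asymp, of 0] by simp
  then have "\<forall>\<^sub>F n in sequentially. q n / (q n / w n) = w n"
    by eventually_elim (auto simp: zero_less_divide_iff)
  ultimately show ?thesis by (simp add: Lim_transform_eventually)
qed

lemma level_works:
  assumes "1 \<le> n"
  shows "1 \<le> level t n" "w (level t n) \<le> t * w n"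
proof -
  have "0 < t * w n" using t w_pos[OF assms] by simp
  then have "eventually (\<lambda>y. w y < t * w n) sequentially"
    by (rule order_tendstoD(2)[OF w_null])
  then have "eventually (\<lambda>y. 1 \<le> y \<and> w y \<le> t * w n) sequentially"
    using eventually_ge_at_top[of 1] by eventually_elim auto
  then have "\<exists>y. 1 \<le> y \<and> w y \<le> t * w n" by (auto simp: eventually_sequentially)
  from LeastI_ex[OF this] show "1 \<le> level t n" "w (level t n) \<le> t * w n"
    by (auto simp: level_def)
qed

lemma level_le_iff: "1 \<le> n \<Longrightarrow> 1 \<le> u \<Longrightarrow> level t n \<le> u \<longleftrightarrow> w u \<le> t * w n"
  using level_works[of n] w_antimono[of "level t n" u] Least_le[of "\<lambda>y. 1 \<le> y \<and> w y \<le> t * w n" u]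
  by (auto simp: level_def)

text \<open>Since \<open>w (2 ^ j * n) / w n\<close> tends to 1 and \<open>t\<close> is below 1,
  \<open>w\<close> is eventually still above \<open>t * w n\<close> at time
  \<open>2 ^ j * n\<close>. This makes displacements of order \<open>n\<close> negligible against
  the level.\<close>

lemma level_ge: "eventually (\<lambda>n. 2 ^ j * n \<le> level t n) sequentially"
  using order_tendstoD(1)[OF w_power_doubling t(2), of j] eventually_ge_at_top[of 1]
proof eventually_elim
  case (elim n)
  then have "t * w n < w (2 ^ j * n)" using w_pos[of n] by (simp add: field_simps)
  show ?case
  proof (rule ccontr)
    assume "\<not> 2 ^ j * n \<le> level t n"
    then have "w (2 ^ j * n) \<le> w (level t n)"
      using level_works[OF elim(2)] by (intro w_antimono) auto
    then show False using level_works[OF elim(2)] \<open>t * w n < w (2 ^ j * n)\<close> by simp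
  qed
qed

lemma level_at_top: "filterlim (level t) at_top sequentially"
  by (rule filterlim_at_top_mono[OF filterlim_ident]) (use level_ge[of 0] in simp)

text \<open>By minimality \<open>w\<close> still exceeds \<open>t * w n\<close> one step before the
  level, and slow variation makes that single step harmless.\<close>

lemma level_ratio: "(\<lambda>n. w (level t n) / w n) \<longlonglongrightarrow> t"
proof (rule tendsto_sandwich)
  have ge: "eventually (\<lambda>n. 2 \<le> level t n) sequentially"
    using level_at_top by (simp add: filterlim_at_top)
  have pre: "filterlim (\<lambda>n. level t n - 1) at_top sequentially"
    "(\<lambda>n. w (level t n - 1) / w (level t n)) \<longlonglongrightarrow> 1"
  proof -
    have "eventually (\<lambda>n. level t n \<le> 2 ^ 1 * (level t n - 1)) sequentially"
      using ge by eventually_elim auto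
    moreover have "eventually (\<lambda>n. level t n - 1 \<le> 2 ^ 0 * level t n) sequentially" by simp
    ultimately show "filterlim (\<lambda>n. level t n - 1) at_top sequentially"
    "(\<lambda>n. w (level t n - 1) / w (level t n)) \<longlonglongrightarrow> 1"
      by (rule w_ratio[OF level_at_top])+
  qed
  show "(\<lambda>n. t / (w (level t n - 1) / w (level t n))) \<longlonglongrightarrow> t"
    using tendsto_divide[OF tendsto_const[of t] pre(2)] by simp
  show "(\<lambda>n::nat. t) \<longlonglongrightarrow> t" by simp
  show "eventually (\<lambda>n. w (level t n) / w n \<le> t) sequentially"
    using eventually_ge_at_top[of 1]
    by eventually_elim (use level_works w_pos in \<open>simp add: divide_le_eq\<close>)
  show "eventually (\<lambda>n. t / (w (level t n - 1) / w (level t n)) \<le> w (level t n) / w n) sequentially"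
    using ge eventually_ge_at_top[of 1]
  proof eventually_elim
    case (elim n)
    then have "1 \<le> level t n - 1" "\<not> level t n \<le> level t n - 1" by auto
    then have "t * w n < w (level t n - 1)"
      using level_le_iff[of n "level t n - 1"] elim(2) by linarith
    then show ?case using w_pos[of n] w_pos[of "level t n"] w_pos[of "level t n - 1"] elim
      by (simp add: field_simps)
  qed
qed

text \<open>\<open>b (m n)\<close> behaves like \<open>1 / w n\<close>, and \<open>q (v n)\<close>
  like \<open>w (level t n)\<close>, hence like \<open>t * w n\<close>. The bounded factors leave
  room for moving both ends of a time window.\<close>

lemma level_limit:
  assumes b: "(\<lambda>n. b n * w n) \<longlonglongrightarrow> 1"
    and m: "eventually (\<lambda>n. n \<le> 2 ^ i * m n) sequentially" "eventually (\<lambda>n. m n \<le> 2 ^ j * n) sequentially"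
    and v: "eventually (\<lambda>n. level t n \<le> 2 ^ k * v n) sequentially" "eventually (\<lambda>n. v n \<le> 2 ^ l * level t n) sequentially"
  shows "(\<lambda>n. b (m n) * q (v n)) \<longlonglongrightarrow> t"
proof -
  have mt: "filterlim m at_top sequentially" and mr: "(\<lambda>n. w (m n) / w n) \<longlonglongrightarrow> 1"
    using w_ratio[OF filterlim_ident m] by auto
  have vt: "filterlim v at_top sequentially" and vr: "(\<lambda>n. w (v n) / w (level t n)) \<longlonglongrightarrow> 1"
    using w_ratio[OF level_at_top v] by auto
  have "(\<lambda>n. (b (m n) * w (m n)) * (q (v n) / w (v n)) * (w (v n) / w (level t n))
      * (w (level t n) / w n) / (w (m n) / w n)) \<longlonglongrightarrow> 1 * 1 * 1 * t / 1"
    by (intro tendsto_intros filterlim_compose[OF b mt] filterlim_compose[OF q_asymp vt] vr mr level_ratio) auto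
  then have "(\<lambda>n. (b (m n) * w (m n)) * (q (v n) / w (v n)) * (w (v n) / w (level t n))
      * (w (level t n) / w n) / (w (m n) / w n)) \<longlonglongrightarrow> t" by simp
  then show ?thesis
  proof (rule Lim_transform_eventually)
    have "eventually (\<lambda>n. 1 \<le> m n) sequentially" "eventually (\<lambda>n. 1 \<le> v n) sequentially"
      "eventually (\<lambda>n. 1 \<le> level t n) sequentially"
      using mt vt level_at_top by (auto simp: filterlim_at_top)
    then show "\<forall>\<^sub>F n in sequentially. (b (m n) * w (m n)) * (q (v n) / w (v n)) * (w (v n) / w (level t n))
      * (w (level t n) / w n) / (w (m n) / w n) = b (m n) * q (v n)"
      using eventually_ge_at_top[of 1]
    proof eventually_elim
      case (elim n)
      then have "w (m n) \<noteq> 0" "w (v n) \<noteq> 0" "w (level t n) \<noteq> 0" "w n \<noteq> 0"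
        using w_pos by (metis less_irrefl)+
      then show ?case by simp
    qed
  qed
qed

end

end


section \<open>Convergence to the uniform law, and averages\<close>

text \<open>Distribution functions are monotone with values in [0, 1], so their limits on the open
  interval force the limits at the end points and outside.\<close>

lemma weak_conv_uniform_01:
  assumes prob: "prob_space N" and X: "\<And>n. X n \<in> borel_measurable N"
    and lim: "\<And>t. 0 < t \<Longrightarrow> t < 1 \<Longrightarrow> (\<lambda>n. measure N {x\<in>space N. X n x \<le> t}) \<longlonglongrightarrow> t"
  shows "weak_conv_m (\<lambda>n. distr N borel (X n)) (uniform_measure lborel {0..1::real})"
proof -
  interpret prob_space N by fact
  have F: "cdf (distr N borel (X n)) t = measure N {x\<in>space N. X n x \<le> t}" for n t
    unfolding cdf_def using X[of n]
    by (subst measure_distr) (auto intro!: arg_cong2[where f=measure])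
  have mono: "measure N {x\<in>space N. X n x \<le> s} \<le> measure N {x\<in>space N. X n x \<le> t}" if "s \<le> t" for n s t
    using X[of n] that by (intro finite_measure_mono) auto
  have G: "cdf (uniform_measure lborel {0..1::real}) t = (if t \<le> 0 then 0 else if t \<le> 1 then t else 1)" for t
  proof -
    have "cdf (uniform_measure lborel {0..1::real}) t = measure lborel ({0..1} \<inter> {..t})"
      unfolding cdf_def by (subst measure_uniform_measure) auto
    also have "{0..1} \<inter> {..t} = {0..min 1 t}" by auto
    finally show ?thesis by (auto simp: min_def)
  qed
  have "(\<lambda>n. measure N {x\<in>space N. X n x \<le> t}) \<longlonglongrightarrow> (if t \<le> 0 then 0 else if t \<le> 1 then t else 1)" for t
  proof -
    consider "t \<le> 0" | "0 < t" "t < 1" | "1 \<le> t" by linarith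
    then show ?thesis
    proof cases
      case 1
      have "(\<lambda>n. measure N {x\<in>space N. X n x \<le> t}) \<longlonglongrightarrow> 0"
      proof (rule order_tendstoI)
        fix a :: real assume "0 < a"
        define s where "s = min a 1 / 2"
        have s: "0 < s" "s < 1" "s < a" using \<open>0 < a\<close> by (auto simp: s_def)
        from order_tendstoD(2)[OF lim[OF s(1,2)] s(3)]
        show "\<forall>\<^sub>F n in sequentially. measure N {x\<in>space N. X n x \<le> t} < a"
          by eventually_elim (use mono[of t s] 1 s in \<open>auto intro: le_less_trans\<close>)
      qed (auto intro!: always_eventually intro: less_le_trans[OF _ measure_nonneg])
      with 1 show ?thesis by simp
    next
      case 2
      then show ?thesis using lim[of t] by simp
    next
      case 3
      have "(\<lambda>n. measure N {x\<in>space N. X n x \<le> t}) \<longlonglongrightarrow> 1"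
      proof (rule order_tendstoI)
        fix a :: real assume "a < 1"
        define s where "s = (max a 0 + 1) / 2"
        have s: "0 < s" "s < 1" "a < s" using \<open>a < 1\<close> by (auto simp: s_def)
        from order_tendstoD(1)[OF lim[OF s(1,2)] s(3)]
        show "\<forall>\<^sub>F n in sequentially. a < measure N {x\<in>space N. X n x \<le> t}"
          by eventually_elim (use mono[of s t] 3 s in \<open>auto intro: less_le_trans\<close>)
      qed (auto intro!: always_eventually intro: le_less_trans[OF prob_le_1])
      with 3 show ?thesis by auto
    qed
  qed
  then show ?thesis unfolding weak_conv_m_def weak_conv_def F G by blast
qed

lemma average_tendsto_1:
  fixes u :: "nat \<Rightarrow> real"
  assumes mono: "incseq u" and u: "\<And>n. 0 \<le> u n" "\<And>n. u n \<le> 1" and lim: "u \<longlonglongrightarrow> 1"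
  shows "(\<lambda>n. (\<Sum>m\<le>n. u m) / real n) \<longlonglongrightarrow> 1"
proof (rule order_tendstoI)
  fix a :: real assume "a < 1"
  define r where "r = (max a 0 + 1) / 2"
  have r: "0 < r" "r < 1" "a < r" using \<open>a < 1\<close> by (auto simp: r_def)
  from order_tendstoD(1)[OF lim r(2)] obtain s where s: "r < u s" by (auto simp: eventually_sequentially)
  have "(\<lambda>n. (1 - real s / real n) * r) \<longlonglongrightarrow> (1 - 0) * r"
    by (intro tendsto_intros real_tendsto_divide_at_top[OF tendsto_const filterlim_real_sequentially])
  then have "eventually (\<lambda>n. a < (1 - real s / real n) * r) sequentially"
    using order_tendstoD(1)[of _ "1 * r" sequentially a] r by simp
  then show "eventually (\<lambda>n. a < (\<Sum>m\<le>n. u m) / real n) sequentially"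
    using eventually_ge_at_top[of "Suc s"]
  proof eventually_elim
    case (elim n)
    have "(real n - real s) * r \<le> (\<Sum>m\<in>{s<..n}. r)" using elim by (simp add: of_nat_diff)
    also have "\<dots> \<le> (\<Sum>m\<in>{s<..n}. u m)"
    proof (rule sum_mono)
      fix m assume "m \<in> {s<..n}"
      then have "u s \<le> u m" using mono by (auto simp: incseq_def)
      with s show "r \<le> u m" by simp
    qed
    also have "\<dots> \<le> (\<Sum>m\<le>n. u m)" by (rule sum_mono2) (use u in auto)
    finally have "(real n - real s) * r / real n \<le> (\<Sum>m\<le>n. u m) / real n" by (intro divide_right_mono) auto
    moreover have "(real n - real s) * r / real n = (1 - real s / real n) * r"
      using elim by (simp add: field_simps)
    ultimately show ?case using elim by linarith
  qed
next
  fix a :: real assume "1 < a"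
  \<comment> \<open>The sum has \<open>n + 1\<close> terms but is divided by
    \<open>n\<close>.\<close>
  have "(\<lambda>n. 1 + 1 / real n) \<longlonglongrightarrow> 1 + 0" by (intro tendsto_intros lim_1_over_n)
  then have "eventually (\<lambda>n. 1 + 1 / real n < a) sequentially"
    using order_tendstoD(2)[of _ 1 sequentially a] \<open>1 < a\<close> by simp
  then show "eventually (\<lambda>n. (\<Sum>m\<le>n. u m) / real n < a) sequentially"
    using eventually_ge_at_top[of 1]
  proof eventually_elim
    case (elim n)
    have "(\<Sum>m\<le>n. u m) \<le> (\<Sum>m\<le>n. 1)" by (intro sum_mono u)
    then have "(\<Sum>m\<le>n. u m) / real n \<le> (1 + real n) / real n" by (intro divide_right_mono) auto
    also have "\<dots> = 1 + 1 / real n" using elim by (simp add: field_simps)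
    finally show ?case using elim by simp
  qed
qed

section \<open>Visits to a set of finite measure\<close>


locale recurrent_system = measure_preserving_system M T for M :: "'a measure" and T +
  fixes A :: "'a set"
  assumes conservative_map: "conservative M T" and ergodic_map: "ergodic M T"
    and A_sets[measurable]: "A \<in> sets M"
    and A_pos: "0 < emeasure M A" and A_finite: "emeasure M A < \<infinity>"
begin

text \<open>For recurrent points and \<open>m \<le> z\<close> this is the event that
  \<open>next_visit T A m x\<close> exceeds \<open>z\<close>; the window is open at \<open>m\<close>
  because a visit at time \<open>m\<close> itself does not count.\<close>

definition no_visit :: "nat \<Rightarrow> nat \<Rightarrow> 'a set" where
  "no_visit m z = {x\<in>space M. \<forall>k. m < k \<and> k \<le> z \<longrightarrow> (T ^^ k) x \<notin> A}"

text \<open>The part of \<open>A\<close> with return time above \<open>k\<close>, phrased through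
  \<open>no_visit\<close> so that shifts of time windows apply without \<open>enat\<close>.\<close>

definition excursion :: "nat \<Rightarrow> 'a set" where
  "excursion k = A \<inter> no_visit 0 k"

definition q :: "nat \<Rightarrow> real" where
  "q k = measure M (excursion k)"

lemma no_visit_sets[measurable]: "no_visit m z \<in> sets M"
proof -
  have "no_visit m z = space M - (\<Union>k\<in>{m<..z}. preimage_iter M T k A)"
    by (auto simp: no_visit_def preimage_iter_def)
  then show ?thesis using preimage_iter_sets[OF A_sets] by (auto intro!: sets.countable_UN)
qed

lemma excursion_sets[measurable]: "excursion k \<in> sets M"
  unfolding excursion_def by measurable

lemma visited_set_sets[measurable]: "visited_set M T A n \<in> sets M"
  unfolding visited_set_def using preimage_iter_sets[OF A_sets] by auto

lemma A_subset_space: "x \<in> A \<Longrightarrow> x \<in> space M"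
  using sets.sets_into_space[OF A_sets] by auto

lemma no_visit_mono: "m' \<le> m \<Longrightarrow> z \<le> z' \<Longrightarrow> no_visit m' z' \<subseteq> no_visit m z"
  by (auto simp: no_visit_def)

lemma excursion_mono: "k \<le> k' \<Longrightarrow> excursion k' \<subseteq> excursion k"
  using no_visit_mono[of 0 0 k k'] by (auto simp: excursion_def)

lemma iterate_in_no_visit:
  assumes "x \<in> space M"
  shows "(T ^^ j) x \<in> no_visit m z \<longleftrightarrow> x \<in> no_visit (m + j) (z + j)"
proof
  assume l: "(T ^^ j) x \<in> no_visit m z"
  have "(T ^^ k) x \<notin> A" if "m + j < k" "k \<le> z + j" for k
  proof -
    have "(T ^^ (k - j)) ((T ^^ j) x) = (T ^^ k) x"
      using that by (simp flip: funpow_add[THEN fun_cong, unfolded comp_def])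
    with l that show ?thesis unfolding no_visit_def
      by (metis (mono_tags, lifting) diff_le_mono diff_less_mono add_diff_cancel_right' le_add2 mem_Collect_eq)
  qed
  with assms show "x \<in> no_visit (m + j) (z + j)" by (simp add: no_visit_def)
next
  assume r: "x \<in> no_visit (m + j) (z + j)"
  have "(T ^^ k) ((T ^^ j) x) \<notin> A" if "m < k" "k \<le> z" for k
  proof -
    have "(T ^^ k) ((T ^^ j) x) = (T ^^ (k + j)) x" by (simp add: funpow_add)
    with r that show ?thesis by (simp add: no_visit_def)
  qed
  with assms show "(T ^^ j) x \<in> no_visit m z" by (simp add: no_visit_def)
qed

lemma excursion_eq_return_time: "{x\<in>A. enat k < return_time T A x} = excursion k"
proof -
  have "enat k < return_time T A x \<longleftrightarrow> (\<forall>n. 0 < n \<and> n \<le> k \<longrightarrow> (T ^^ n) x \<notin> A)" for x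
  proof
    assume less: "enat k < return_time T A x"
    show "\<forall>n. 0 < n \<and> n \<le> k \<longrightarrow> (T ^^ n) x \<notin> A"
    proof (intro allI impI notI)
      fix n assume n: "0 < n \<and> n \<le> k" and "(T ^^ n) x \<in> A"
      then have "return_time T A x \<le> enat n"
        unfolding return_time_def by (intro Inf_lower) (auto simp: Suc_le_eq)
      with less have "enat k < enat n" by (rule less_le_trans)
      with n show False by simp
    qed
  next
    assume nv: "\<forall>n. 0 < n \<and> n \<le> k \<longrightarrow> (T ^^ n) x \<notin> A"
    have "enat (Suc k) \<le> return_time T A x"
      unfolding return_time_def
    proof (rule Inf_greatest)
      fix u assume "u \<in> {enat n |n. 1 \<le> n \<and> (T ^^ n) x \<in> A}"
      then obtain n where n: "u = enat n" "1 \<le> n" "(T ^^ n) x \<in> A" by blast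
      then have "\<not> n \<le> k" using nv by auto
      with n show "enat (Suc k) \<le> u" by simp
    qed
    moreover have "enat k < enat (Suc k)" by simp
    ultimately show "enat k < return_time T A x" by (metis less_le_trans)
  qed
  then show ?thesis by (auto simp: excursion_def no_visit_def A_subset_space)
qed

lemma tail_sum_eq: "tail_sum M T A n = (\<Sum>k\<le>n. q k)"
  by (simp add: tail_sum_def excursion_eq_return_time q_def)

lemma excursion_finite: "emeasure M (excursion k) < \<infinity>"
proof -
  have "emeasure M (excursion k) \<le> emeasure M A"
    by (rule emeasure_mono) (auto simp: excursion_def)
  then show ?thesis using A_finite by (rule le_less_trans)
qed

lemma visited_set_0: "visited_set M T A 0 = excursion 0"
  by (auto simp: visited_set_def preimage_iter_def excursion_def no_visit_def A_subset_space)

text \<open>A visit of \<open>x\<close> at one of the times 1 to \<open>n + 1\<close> is a visit of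
  \<open>T x\<close> at one of the times 0 to \<open>n\<close>; any other visited point starts in
  \<open>A\<close> and then stays away. With invariance of \<open>M\<close> this gives the formula
  for the wandering rate.\<close>

lemma visited_set_Suc:
  "visited_set M T A (Suc n) = preimage_iter M T 1 (visited_set M T A n) \<union> excursion (Suc n)"
  "preimage_iter M T 1 (visited_set M T A n) \<inter> excursion (Suc n) = {}"
proof -
  have v: "x \<in> visited_set M T A n \<longleftrightarrow> x \<in> space M \<and> (\<exists>k\<le>n. (T ^^ k) x \<in> A)" for x n
    by (auto simp: visited_set_def preimage_iter_def)
  have s: "(T ^^ k) (T x) = (T ^^ Suc k) x" for k x by (simp add: funpow_swap1)
  have p: "x \<in> preimage_iter M T 1 (visited_set M T A n) \<longleftrightarrow> x \<in> space M \<and> (\<exists>k\<le>n. (T ^^ Suc k) x \<in> A)" for x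
    using s by (auto simp: preimage_iter_def v)
  have e: "x \<in> excursion (Suc n) \<longleftrightarrow> x \<in> A \<and> (\<forall>k\<le>n. (T ^^ Suc k) x \<notin> A)" for x
  proof
    assume "x \<in> excursion (Suc n)"
    then show "x \<in> A \<and> (\<forall>k\<le>n. (T ^^ Suc k) x \<notin> A)"
      unfolding excursion_def no_visit_def by blast
  next
    assume a: "x \<in> A \<and> (\<forall>k\<le>n. (T ^^ Suc k) x \<notin> A)"
    have "(T ^^ k) x \<notin> A" if "0 < k" "k \<le> Suc n" for k
      using a that by (cases k) auto
    with a show "x \<in> excursion (Suc n)" by (auto simp: excursion_def no_visit_def A_subset_space)
  qed
  show "visited_set M T A (Suc n) = preimage_iter M T 1 (visited_set M T A n) \<union> excursion (Suc n)"
  proof (intro set_eqI iffI)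
    fix x assume "x \<in> visited_set M T A (Suc n)"
    then obtain k where k: "x \<in> space M" "k \<le> Suc n" "(T ^^ k) x \<in> A" by (auto simp: v)
    show "x \<in> preimage_iter M T 1 (visited_set M T A n) \<union> excursion (Suc n)"
    proof (cases k)
      case 0
      then show ?thesis using k p e by auto
    next
      case (Suc j)
      then show ?thesis using k p by auto
    qed
  next
    fix x assume "x \<in> preimage_iter M T 1 (visited_set M T A n) \<union> excursion (Suc n)"
    then consider "x \<in> space M \<and> (\<exists>k\<le>n. (T ^^ Suc k) x \<in> A)" | "x \<in> A"
      unfolding Un_iff p e by blast
    then show "x \<in> visited_set M T A (Suc n)"
    proof cases
      case 1
      then show ?thesis unfolding v by (meson Suc_le_mono)
    next
      case 2
      then show ?thesis unfolding v by (intro conjI exI[of _ 0]) (auto simp: A_subset_space)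
    qed
  qed
  show "preimage_iter M T 1 (visited_set M T A n) \<inter> excursion (Suc n) = {}"
    using p e by blast
qed

lemma wandering_rate_eq: "wandering_rate M T A n = (\<Sum>k\<le>n. q k)"
proof -
  have "emeasure M (visited_set M T A n) = ennreal (\<Sum>k\<le>n. q k)"
  proof (induction n)
    case 0
    then show ?case using excursion_finite[of 0] by (simp add: visited_set_0 q_def emeasure_eq_ennreal_measure)
  next
    case (Suc n)
    have "emeasure M (visited_set M T A (Suc n))
        = emeasure M (preimage_iter M T 1 (visited_set M T A n)) + emeasure M (excursion (Suc n))"
      unfolding visited_set_Suc(1)
      by (rule plus_emeasure[symmetric]) (use visited_set_Suc(2) in auto)
    also have "\<dots> = ennreal (\<Sum>k\<le>n. q k) + ennreal (q (Suc n))"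
      using excursion_finite[of "Suc n"] unfolding emeasure_preimage_iter[OF visited_set_sets] Suc
      by (simp add: q_def emeasure_eq_ennreal_measure)
    finally show ?case by (simp add: ennreal_plus[symmetric] q_def sum_nonneg del: ennreal_plus)
  qed
  then show ?thesis unfolding wandering_rate_def measure_def by (simp add: q_def sum_nonneg)
qed

text \<open>This set is wandering: a common point of two of its preimages would visit
  \<open>A\<close> at the later time after having left it for good at the earlier one. Here
  conservativity enters.\<close>

lemma never_return_null: "A \<inter> (\<Inter>k. no_visit 0 k) \<in> null_sets M"
proof -
  let ?B = "A \<inter> (\<Inter>k. no_visit 0 k)"
  have B: "?B \<in> sets M" by (auto intro!: sets.countable_INT)
  have "disjoint_family (\<lambda>n. preimage_iter M T n ?B)"
  proof -
    have F: False if ij: "i < j" and x: "x \<in> preimage_iter M T i ?B" "x \<in> preimage_iter M T j ?B" for i j x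
    proof -
      have xs: "x \<in> space M" using x by (auto simp: preimage_iter_def)
      have "(T ^^ i) x \<in> no_visit 0 (j - i)" "(T ^^ j) x \<in> A"
        using x by (auto simp: preimage_iter_def)
      then have "x \<in> no_visit i j" using iterate_in_no_visit[OF xs, of i 0 "j - i"] ij by simp
      with \<open>(T ^^ j) x \<in> A\<close> ij show False by (auto simp: no_visit_def)
    qed
    show ?thesis unfolding disjoint_family_on_def
      using F by (metis disjoint_iff nat_neq_iff)
  qed
  with B show ?thesis using conservative_map unfolding conservative_def wandering_def by blast
qed

text \<open>A point of \<open>A\<close> that is not recurrent has a last visit, where it lies in the
  null set of points that never return. So the invariant recurrence set contains almost all of
  \<open>A\<close>, is not null, and is full by ergodicity.\<close>

lemma AE_recurrent: "AE x in M. x \<in> recurrence_set A"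
proof -
  let ?B = "A \<inter> (\<Inter>k. no_visit 0 k)"
  let ?E = "recurrence_set A"
  have B0: "?B \<in> null_sets M" by (rule never_return_null)
  then have "preimage_iter M T k ?B \<in> null_sets M" for k
    using emeasure_preimage_iter[of ?B k] preimage_iter_sets[of ?B k]
    by (auto simp: null_setsD1 intro!: null_setsI)
  then have U: "(\<Union>k. preimage_iter M T k ?B) \<in> null_sets M" by auto
  have "A - ?E \<subseteq> (\<Union>k. preimage_iter M T k ?B)"
  proof
    fix x assume x: "x \<in> A - ?E"
    then have xs: "x \<in> space M" by (simp add: A_subset_space)
    with x obtain n where n: "\<And>k. k \<ge> n \<Longrightarrow> (T ^^ k) x \<notin> A" by (auto simp: recurrence_set_def)
    define S where "S = {k. (T ^^ k) x \<in> A}"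
    have "S \<subseteq> {..<n}" using n by (auto simp: S_def not_le[symmetric])
    then have fS: "finite S" by (rule finite_subset) simp
    have "0 \<in> S" using x by (simp add: S_def)
    define k where "k = Max S"
    have "k \<in> S" unfolding k_def using Max_in[OF fS] \<open>0 \<in> S\<close> by blast
    then have k: "(T ^^ k) x \<in> A" by (simp add: S_def)
    have "j \<notin> S" if "k < j" for j
      using Max_ge[OF fS, of j] that by (auto simp: k_def[symmetric])
    then have "(T ^^ j) x \<notin> A" if "k < j" for j using that by (simp add: S_def)
    then have "x \<in> no_visit k (i + k)" for i using xs by (simp add: no_visit_def)
    then have "(T ^^ k) x \<in> no_visit 0 i" for i using iterate_in_no_visit[OF xs, of k 0 i] by simp
    with k xs show "x \<in> (\<Union>k. preimage_iter M T k ?B)" by (auto simp: preimage_iter_def)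
  qed
  then have AE0: "A - ?E \<in> null_sets M" by (intro null_sets_subset[OF U]) auto
  have "?E \<notin> null_sets M"
  proof
    assume "?E \<in> null_sets M"
    then have "(A - ?E) \<union> ?E \<in> null_sets M" using AE0 by blast
    then have "A \<in> null_sets M" by (rule null_sets_subset) auto
    then show False using A_pos by (simp add: null_setsD1)
  qed
  moreover have "?E \<in> sets M" by simp
  ultimately have "space M - ?E \<in> null_sets M"
    using ergodic_map recurrence_set_invariant[of A] unfolding ergodic_def by blast
  then have "AE x in M. x \<notin> space M - ?E" by (rule AE_not_in)
  then show ?thesis using AE_space by eventually_elim auto
qed

lemma q_tendsto_0: "q \<longlonglongrightarrow> 0"
proof -
  have "(\<lambda>k. measure M (excursion k)) \<longlonglongrightarrow> measure M (\<Inter>k. excursion k)"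
    using excursion_finite excursion_mono
    by (intro Lim_measure_decseq) (auto simp: decseq_def less_top[symmetric])
  moreover have "(\<Inter>k. excursion k) = A \<inter> (\<Inter>k. no_visit 0 k)" by (auto simp: excursion_def)
  moreover have "measure M (A \<inter> (\<Inter>k. no_visit 0 k)) = 0"
    using never_return_null by (simp add: measure_eq_0_null_sets)
  ultimately show ?thesis by (simp add: q_def[abs_def])
qed

lemma ac_probsD:
  assumes "N \<in> ac_probs M"
  shows "prob_space N" "sets N = sets M" "space N = space M"
    "(AE x in M. P x) \<Longrightarrow> (AE x in N. P x)"
proof -
  show s: "prob_space N" "sets N = sets M" using assms by (auto simp: ac_probs_def)
  then show "space N = space M" by (metis sets_eq_imp_space_eq)
  show "(AE x in M. P x) \<Longrightarrow> (AE x in N. P x)"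
    using assms absolutely_continuous_AE[of N M P] by (auto simp: ac_probs_def)
qed

lemma visited_set_mono: "m \<le> n \<Longrightarrow> visited_set M T A m \<subseteq> visited_set M T A n"
  by (auto simp: visited_set_def intro: order_trans)

lemma visited_set_tendsto_1:
  assumes "N \<in> ac_probs M"
  shows "(\<lambda>n. measure N (visited_set M T A n)) \<longlonglongrightarrow> 1"
proof -
  interpret N: prob_space N using ac_probsD[OF assms] by blast
  note sN = ac_probsD(2,3)[OF assms]
  have "(\<lambda>n. measure N (visited_set M T A n)) \<longlonglongrightarrow> measure N (\<Union>n. visited_set M T A n)"
    using visited_set_mono sN by (intro N.finite_Lim_measure_incseq) (auto simp: incseq_def)
  moreover have "AE x in M. x \<in> (\<Union>n. visited_set M T A n)"
    using AE_recurrent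
  proof eventually_elim
    case (elim x)
    then have "x \<in> space M" "\<exists>k\<ge>0. (T ^^ k) x \<in> A" unfolding recurrence_set_def by blast+
    then show ?case by (auto simp: visited_set_def preimage_iter_def)
  qed
  then have "AE x in N. x \<in> (\<Union>n. visited_set M T A n)" by (rule ac_probsD(4)[OF assms])
  then have "measure N (\<Union>n. visited_set M T A n) = 1"
    using sN by (subst N.prob_eq_1) auto
  ultimately show ?thesis by simp
qed

text \<open>Decomposition according to the last visit up to time \<open>m\<close>.\<close>

lemma measure_visited_no_visit:
  assumes N: "finite_measure N" "sets N = sets M" and mz: "m \<le> z"
  shows "measure N (visited_set M T A m \<inter> no_visit m z)
    = (\<Sum>k\<le>m. measure N (preimage_iter M T k (excursion (z - k))))"
proof -
  interpret N: finite_measure N by fact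
  have in_pre: "x \<in> preimage_iter M T k (excursion (z - k))
      \<longleftrightarrow> x \<in> space M \<and> (T ^^ k) x \<in> A \<and> x \<in> no_visit k z" if "k \<le> m" for x k
    using iterate_in_no_visit[of x k 0 "z - k"] that mz by (auto simp: preimage_iter_def excursion_def)
  have "visited_set M T A m \<inter> no_visit m z = (\<Union>k\<le>m. preimage_iter M T k (excursion (z - k)))"
  proof (intro set_eqI iffI)
    fix x assume x: "x \<in> visited_set M T A m \<inter> no_visit m z"
    then have xs: "x \<in> space M" by (simp add: no_visit_def)
    define S where "S = {k. k \<le> m \<and> (T ^^ k) x \<in> A}"
    have fS: "finite S" by (simp add: S_def)
    have "S \<noteq> {}" using x by (auto simp: S_def visited_set_def preimage_iter_def)
    define k where "k = Max S"
    have "k \<in> S" unfolding k_def using Max_in[OF fS \<open>S \<noteq> {}\<close>] .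
    then have k: "k \<le> m" "(T ^^ k) x \<in> A" by (auto simp: S_def)
    have kmax: "j \<notin> S" if "k < j" for j
      using Max_ge[OF fS, of j] that by (auto simp: k_def[symmetric])
    have "(T ^^ j) x \<notin> A" if "k < j" "j \<le> z" for j
    proof (cases "j \<le> m")
      case True
      then show ?thesis using kmax[OF that(1)] by (simp add: S_def)
    next
      case False
      then show ?thesis using x that by (auto simp: no_visit_def)
    qed
    then have "x \<in> no_visit k z" using xs by (simp add: no_visit_def)
    with k xs show "x \<in> (\<Union>k\<le>m. preimage_iter M T k (excursion (z - k)))" using in_pre by auto
  next
    fix x assume "x \<in> (\<Union>k\<le>m. preimage_iter M T k (excursion (z - k)))"
    then obtain k where k: "k \<le> m" "x \<in> space M" "(T ^^ k) x \<in> A" "x \<in> no_visit k z" using in_pre by auto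
    then show "x \<in> visited_set M T A m \<inter> no_visit m z"
      using no_visit_mono[of k m z z] by (auto simp: visited_set_def preimage_iter_def)
  qed
  moreover have "disjoint_family_on (\<lambda>k. preimage_iter M T k (excursion (z - k))) {..m}"
  proof -
    have F: False if "i < j" "j \<le> m" "x \<in> preimage_iter M T i (excursion (z - i))"
      "x \<in> preimage_iter M T j (excursion (z - j))" for i j x
      using that in_pre[of i x] in_pre[of j x] mz by (auto simp: no_visit_def)
    show ?thesis unfolding disjoint_family_on_def
      using F by (metis atMost_iff disjoint_iff nat_neq_iff)
  qed
  ultimately show ?thesis
    using N(2) by (simp add: N.finite_measure_finite_Union preimage_iter_sets image_subset_iff)
qed

text \<open>Averaging the indicator over \<open>L n\<close> shifts makes it asymptotically invariant, at the cost
  of moving the endpoints of the time window by at most \<open>L n\<close>.\<close>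

lemma no_visit_change_of_measure:
  assumes N: "N \<in> ac_probs M" and N': "N' \<in> ac_probs M"
    and L: "filterlim L at_top sequentially"
  obtains \<delta> where "\<delta> \<longlonglongrightarrow> (0::real)"
    "eventually (\<lambda>n. measure N' (no_visit (m n) (z n + L n)) + \<delta> n \<le> measure N (no_visit (m n + L n) (z n))) sequentially"
proof -
  define \<Phi> where "\<Phi> = (\<lambda>n x. (\<Sum>j<L n. indicator (no_visit (m n) (z n)) ((T ^^ j) x)) / real (L n))"
  have meas: "\<Phi> n \<in> borel_measurable M" for n
    unfolding \<Phi>_def by measurable
  have b0: "0 \<le> \<Phi> n x" for n x unfolding \<Phi>_def by (intro divide_nonneg_nonneg sum_nonneg) auto
  have b1: "\<Phi> n x \<le> 1" for n x
  proof -
    have "(\<Sum>j<L n. indicator (no_visit (m n) (z n)) ((T ^^ j) x)) \<le> (\<Sum>j<L n. 1::real)"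
      by (intro sum_mono) (simp add: indicator_def)
    then show ?thesis unfolding \<Phi>_def by (simp add: divide_le_eq)
  qed
  have inv: "\<bar>\<Phi> n (T x) - \<Phi> n x\<bar> \<le> 1 / real (L n)" if "x \<in> space M" for n x
  proof -
    let ?g = "\<lambda>j. indicator (no_visit (m n) (z n)) ((T ^^ j) x) :: real"
    have s: "(T ^^ j) (T x) = (T ^^ Suc j) x" for j by (simp add: funpow_swap1)
    have "\<Phi> n (T x) - \<Phi> n x = ((\<Sum>j<L n. ?g (Suc j)) - (\<Sum>j<L n. ?g j)) / real (L n)"
      unfolding \<Phi>_def s by (simp add: diff_divide_distrib)
    also have "\<dots> = (?g (L n) - ?g 0) / real (L n)"
      using sum_lessThan_telescope[of ?g "L n"] by (simp add: sum_subtractf)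
    finally have e: "\<Phi> n (T x) - \<Phi> n x = (?g (L n) - ?g 0) / real (L n)" .
    have "\<bar>?g (L n) - ?g 0\<bar> \<le> 1" by (simp add: indicator_def)
    then show ?thesis unfolding e by (simp add: abs_divide divide_right_mono)
  qed
  have c: "(\<lambda>n. 1 / real (L n)) \<longlonglongrightarrow> 0"
    using filterlim_compose[OF lim_1_over_n L] .
  have lim: "(\<lambda>n. (LINT x|N. \<Phi> n x) - (LINT x|N'. \<Phi> n x)) \<longlonglongrightarrow> 0"
    using ergodic_asymptotic_invariance[OF ergodic_map meas b0 b1 inv c N N'] .
  have int: "integrable K (\<Phi> n)" if "K \<in> ac_probs M" for K n
  proof -
    interpret K: prob_space K using ac_probsD[OF that] by blast
    have "\<Phi> n \<in> borel_measurable K" using meas[of n]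
      unfolding measurable_cong_sets[OF ac_probsD(2)[OF that] refl] .
    then show ?thesis by (intro K.integrable_const_bound[of _ 1]) (use b0 b1 in auto)
  qed
  have ind: "integrable K (indicator B :: 'a \<Rightarrow> real)" "(LINT x|K. indicator B x) = measure K B"
    if "K \<in> ac_probs M" "B \<in> sets M" for K B
  proof -
    interpret K: prob_space K using ac_probsD[OF that(1)] by blast
    show "integrable K (indicator B :: 'a \<Rightarrow> real)" "(LINT x|K. indicator B x) = measure K B"
      using that(2) ac_probsD(2,3)[OF that(1)] sets.sets_into_space[OF that(2)]
      by (auto simp: K.emeasure_eq_measure Int_absorb1)
  qed
  \<comment> \<open>Each shifted window from \<open>m n + j\<close> to \<open>z n + j\<close> with
    \<open>j < L n\<close> contains the one from \<open>m n + L n\<close> to \<open>z n\<close>, so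
    the average vanishes off this event.\<close>
  have up: "(LINT x|N. \<Phi> n x) \<le> measure N (no_visit (m n + L n) (z n))" for n
  proof -
    have "(LINT x|N. \<Phi> n x) \<le> (LINT x|N. indicator (no_visit (m n + L n) (z n)) x)"
    proof (rule integral_mono[OF int[OF N] ind(1)[OF N]])
      fix x assume "x \<in> space N"
      then have xs: "x \<in> space M" using ac_probsD(3)[OF N] by simp
      show "\<Phi> n x \<le> indicator (no_visit (m n + L n) (z n)) x"
      proof (cases "x \<in> no_visit (m n + L n) (z n)")
        case False
        have "(T ^^ j) x \<notin> no_visit (m n) (z n)" if "j < L n" for j
          using iterate_in_no_visit[OF xs, of j "m n" "z n"] False that
            no_visit_mono[of "m n + j" "m n + L n" "z n" "z n + j"] by auto
        then show ?thesis unfolding \<Phi>_def by simp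
      qed (simp add: b1)
    qed simp
    then show ?thesis unfolding ind(2)[OF N no_visit_sets] .
  qed
  \<comment> \<open>All shifted windows lie between \<open>m n\<close> and \<open>z n + L n\<close>,
    so on this event the average equals 1; \<open>1 \<le> L n\<close> excludes the empty average,
    which is 0.\<close>
  have lo: "measure N' (no_visit (m n) (z n + L n)) \<le> (LINT x|N'. \<Phi> n x)" if L1: "1 \<le> L n" for n
  proof -
    have "(LINT x|N'. indicator (no_visit (m n) (z n + L n)) x) \<le> (LINT x|N'. \<Phi> n x)"
    proof (rule integral_mono[OF ind(1)[OF N'] int[OF N']])
      fix x assume "x \<in> space N'"
      then have xs: "x \<in> space M" using ac_probsD(3)[OF N'] by simp
      show "indicator (no_visit (m n) (z n + L n)) x \<le> \<Phi> n x"
      proof (cases "x \<in> no_visit (m n) (z n + L n)")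
        case True
        have "(T ^^ j) x \<in> no_visit (m n) (z n)" if "j < L n" for j
          using iterate_in_no_visit[OF xs, of j "m n" "z n"] True that
            no_visit_mono[of "m n" "m n + j" "z n + j" "z n + L n"] by auto
        then show ?thesis using L1 unfolding \<Phi>_def by simp
      qed (simp add: b0)
    qed simp
    then show ?thesis unfolding ind(2)[OF N' no_visit_sets] .
  qed
  have "eventually (\<lambda>n. 1 \<le> L n) sequentially" using L by (simp add: filterlim_at_top)
  then have "eventually (\<lambda>n. measure N' (no_visit (m n) (z n + L n)) + ((LINT x|N. \<Phi> n x) - (LINT x|N'. \<Phi> n x))
      \<le> measure N (no_visit (m n + L n) (z n))) sequentially"
    by eventually_elim (use up lo in \<open>smt (verit)\<close>)
  with lim show thesis by (rule that)
qed

end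

section \<open>Uniform sets\<close>


context measure_preserving_system
begin

lemma
  assumes f: "integrable M f"
  shows transfer_iterate_integrable: "integrable M ((transfer_op M T ^^ k) f)"
    and transfer_iterate_set_integral: "B \<in> sets M \<Longrightarrow>
      (LINT x:B|M. (transfer_op M T ^^ k) f x) = (LINT x:preimage_iter M T k B|M. f x)"
proof -
  have "integrable M ((transfer_op M T ^^ k) f) \<and> (\<forall>B\<in>sets M.
      (LINT x:B|M. (transfer_op M T ^^ k) f x) = (LINT x:preimage_iter M T k B|M. f x))"
  proof (induction k)
    case 0
    have "preimage_iter M T 0 B = B" if "B \<in> sets M" for B
      using sets.sets_into_space[OF that] by (auto simp: preimage_iter_def)
    with f show ?case by simp
  next
    case (Suc k)
    have c: "preimage_iter M T k (preimage_iter M T 1 B) = preimage_iter M T (Suc k) B" for B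
      by (auto simp: preimage_iter_def)
    have i: "integrable M ((transfer_op M T ^^ k) f)" using Suc by blast
    note sf = sigma_finite_measure_axioms
    show ?case
    proof (intro conjI ballI)
      show "integrable M ((transfer_op M T ^^ Suc k) f)"
        using transfer_op_integrable[OF sf preserving i] by simp
      fix B assume B: "B \<in> sets M"
      have "(LINT x:B|M. (transfer_op M T ^^ Suc k) f x)
          = (LINT x:preimage_iter M T 1 B|M. (transfer_op M T ^^ k) f x)"
        using transfer_op_set_integral[OF sf preserving i B] by simp
      also have "\<dots> = (LINT x:preimage_iter M T (Suc k) B|M. f x)"
        using Suc preimage_iter_sets[OF B, of 1] c[of B] by simp
      finally show "(LINT x:B|M. (transfer_op M T ^^ Suc k) f x) = (LINT x:preimage_iter M T (Suc k) B|M. f x)" .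
    qed
  qed
  then show "integrable M ((transfer_op M T ^^ k) f)" "B \<in> sets M \<Longrightarrow>
      (LINT x:B|M. (transfer_op M T ^^ k) f x) = (LINT x:preimage_iter M T k B|M. f x)" by auto
qed

lemma ac_prob_density_integrable:
  assumes "f \<in> ac_prob_densities M"
  shows "integrable M f"
    and "B \<in> sets M \<Longrightarrow> measure (density M (\<lambda>x. ennreal (f x))) B = (LINT x:B|M. f x)"
proof -
  have [measurable]: "f \<in> borel_measurable M" and nn: "AE x in M. 0 \<le> f x"
    and p: "prob_space (density M (\<lambda>x. ennreal (f x)))"
    using assms by (auto simp: ac_prob_densities_def ac_probs_def)
  interpret p: prob_space "density M (\<lambda>x. ennreal (f x))" by fact
  have "emeasure (density M (\<lambda>x. ennreal (f x))) (space M) = (\<integral>\<^sup>+x. ennreal (f x) \<partial>M)"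
    by (simp add: emeasure_density cong: nn_integral_cong)
  then have "(\<integral>\<^sup>+x. ennreal (f x) \<partial>M) = 1" using p.emeasure_space_1 by simp
  then show f: "integrable M f" by (intro integrableI_nonneg nn) auto
  assume B: "B \<in> sets M"
  have "emeasure (density M (\<lambda>x. ennreal (f x))) B = (\<integral>\<^sup>+x. ennreal (indicator B x * f x) \<partial>M)"
    using B by (subst emeasure_density) (auto intro!: nn_integral_cong simp: indicator_def)
  also have "\<dots> = ennreal (LINT x|M. indicator B x * f x)"
    using integrable_mult_indicator[OF B f] nn by (intro nn_integral_eq_integral) auto
  finally have "emeasure (density M (\<lambda>x. ennreal (f x))) B = ennreal (LINT x|M. indicator B x * f x)" .
  moreover have "0 \<le> (LINT x|M. indicator B x * f x)"
    using nn by (intro integral_nonneg_AE) auto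
  ultimately show "measure (density M (\<lambda>x. ennreal (f x))) B = (LINT x:B|M. f x)"
    by (simp add: measure_def set_lebesgue_integral_def)
qed

text \<open>Integrating the uniform estimate over \<open>B\<close> gives an error proportional to
  \<open>measure M B\<close>, with the same \<open>e n\<close> for all \<open>B\<close> at once. The
  relative form is essential, because the sets used later are excursions, whose measures tend to
  0.\<close>

lemma uniform_for_expected_visits:
  assumes A: "A \<in> sets M" "0 < emeasure M A" "emeasure M A < \<infinity>"
    and f: "f \<in> ac_prob_densities M" and unif: "uniform_for M T A f"
  obtains b e :: "nat \<Rightarrow> real" where "\<And>n. 0 < b n" "e \<longlonglongrightarrow> 0"
    "eventually (\<lambda>n. \<forall>B\<in>sets M. B \<subseteq> A \<longrightarrow>
        (1 - e n) * b n * measure M B \<le> (\<Sum>k\<le>n. measure (density M (\<lambda>x. ennreal (f x))) (preimage_iter M T k B)) \<and>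
        (\<Sum>k\<le>n. measure (density M (\<lambda>x. ennreal (f x))) (preimage_iter M T k B)) \<le> (1 + e n) * b n * measure M B) sequentially"
proof -
  note fi = ac_prob_density_integrable[OF f]
  define S where "S = (\<lambda>n x. \<Sum>k\<le>n. (transfer_op M T ^^ k) f x)"
  obtain d :: "nat \<Rightarrow> real" and Z where d: "\<And>n. 0 < d n" and Z: "Z \<in> null_sets M"
    and ul: "uniform_limit (A - Z) (\<lambda>n x. (\<Sum>k<n. (transfer_op M T ^^ k) f x) / d n) (\<lambda>x. 1) sequentially"
    using unif unfolding uniform_for_def by blast
  \<comment> \<open>\<open>uniform_for\<close> sums over \<open>k < n\<close>, this lemma over
    \<open>k \<le> n\<close>, hence the shift by one.\<close>
  define b where "b = (\<lambda>n. d (Suc n))"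
  \<comment> \<open>Early sums may deviate without bound on \<open>A\<close>. Truncating at 1 keeps
    every supremum finite, and is inactive as soon as \<open>e n < 1\<close>.\<close>
  define dev where "dev = (\<lambda>n x. min 1 \<bar>S n x / b n - 1\<bar>)"
  define e where "e = (\<lambda>n. SUP x\<in>A - Z. dev n x)"
  have ne: "A - Z \<noteq> {}"
  proof
    assume "A - Z = {}"
    then have "A \<in> null_sets M" using A(1) by (intro null_sets_subset[OF Z]) auto
    then show False using A(2) by (simp add: null_setsD1)
  qed
  have bdd: "bdd_above (dev n ` (A - Z))" for n by (rule bdd_aboveI[of _ 1]) (auto simp: dev_def)
  have dev_le: "dev n x \<le> e n" if "x \<in> A - Z" for n x
    unfolding e_def by (rule cSUP_upper[OF that bdd])
  have e0: "0 \<le> e n" for n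
  proof -
    obtain x where x: "x \<in> A - Z" using ne by blast
    have "0 \<le> dev n x" by (simp add: dev_def)
    with dev_le[OF x] show ?thesis by (rule order_trans[rotated])
  qed
  have e_lim: "e \<longlonglongrightarrow> 0"
  proof (rule order_tendstoI)
    fix a :: real assume "0 < a"
    then have "eventually (\<lambda>n. \<forall>x\<in>A - Z. dist ((\<Sum>k<n. (transfer_op M T ^^ k) f x) / d n) 1 < a / 2) sequentially"
      using uniform_limitD[OF ul, of "a / 2"] by simp
    then have "eventually (\<lambda>n. \<forall>x\<in>A - Z. dist ((\<Sum>k<Suc n. (transfer_op M T ^^ k) f x) / d (Suc n)) 1 < a / 2) sequentially"
      by (subst eventually_sequentially_Suc)
    then show "eventually (\<lambda>n. e n < a) sequentially"
    proof eventually_elim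
      case (elim n)
      have "dev n x \<le> a / 2" if "x \<in> A - Z" for x
        using elim that unfolding dev_def S_def b_def dist_real_def lessThan_Suc_atMost
        by (intro min.coboundedI2) (metis less_imp_le)
      then have "e n \<le> a / 2" unfolding e_def by (intro cSUP_least[OF ne]) auto
      with \<open>0 < a\<close> show ?case by simp
    qed
  next
    fix a :: real assume "a < 0"
    then have "a < e n" for n using e0[of n] by linarith
    then show "eventually (\<lambda>n. a < e n) sequentially" by simp
  qed
  have "eventually (\<lambda>n. e n < 1) sequentially" by (rule order_tendstoD(2)[OF e_lim]) simp
  then have "eventually (\<lambda>n. \<forall>B\<in>sets M. B \<subseteq> A \<longrightarrow>
        (1 - e n) * b n * measure M B \<le> (\<Sum>k\<le>n. measure (density M (\<lambda>x. ennreal (f x))) (preimage_iter M T k B)) \<and>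
        (\<Sum>k\<le>n. measure (density M (\<lambda>x. ennreal (f x))) (preimage_iter M T k B)) \<le> (1 + e n) * b n * measure M B) sequentially"
  proof eventually_elim
    case (elim n)
    have bp: "0 < b n" by (simp add: b_def d)
    have bounds: "(1 - e n) * b n \<le> S n x" "S n x \<le> (1 + e n) * b n" if "x \<in> A - Z" for x
    proof -
      have "\<bar>S n x / b n - 1\<bar> \<le> e n" using dev_le[OF that, of n] elim by (simp add: dev_def min_def split: if_splits)
      then have "1 - e n \<le> S n x / b n" "S n x / b n \<le> 1 + e n" by linarith+
      then show "(1 - e n) * b n \<le> S n x" "S n x \<le> (1 + e n) * b n"
        using bp by (simp_all add: le_divide_eq divide_le_eq)
    qed
    have Sint: "integrable M (S n)"
      unfolding S_def by (intro Bochner_Integration.integrable_sum transfer_iterate_integrable fi(1))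
    show ?case
    proof (intro ballI impI)
      fix B assume B: "B \<in> sets M" "B \<subseteq> A"
      have Bfin: "emeasure M B < \<infinity>" using emeasure_mono[OF B(2) A(1)] A(3) by (rule le_less_trans)
      have si: "set_integrable M B g" if "integrable M g" for g :: "'a \<Rightarrow> real"
        using that integrable_mult_indicator[OF B(1), of g] by (simp add: set_integrable_def)
      have "(\<Sum>k\<le>n. measure (density M (\<lambda>x. ennreal (f x))) (preimage_iter M T k B))
          = (\<Sum>k\<le>n. LINT x:B|M. (transfer_op M T ^^ k) f x)"
        using B(1) by (intro sum.cong refl) (simp add: fi(2) preimage_iter_sets transfer_iterate_set_integral[OF fi(1)])
      also have "\<dots> = (LINT x:B|M. S n x)"
        unfolding S_def set_lebesgue_integral_def sum_distrib_left scaleR_sum_right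
        by (rule Bochner_Integration.integral_sum[symmetric])
          (use si[OF transfer_iterate_integrable[OF fi(1)]] in \<open>simp add: set_integrable_def\<close>)
      finally have sum_eq: "(\<Sum>k\<le>n. measure (density M (\<lambda>x. ennreal (f x))) (preimage_iter M T k B)) = (LINT x:B|M. S n x)" .
      have ci: "set_integrable M B (\<lambda>x. c)" for c :: real
        using B(1) Bfin by (simp add: set_integrable_def)
      have cv: "(LINT x:B|M. c) = c * measure M B" for c :: real
        using B(1) Bfin by (simp add: set_lebesgue_integral_def)
      have AEZ: "AE x in M. x \<notin> Z" using Z by (rule AE_not_in)
      have lo: "(LINT x:B|M. (1 - e n) * b n) \<le> (LINT x:B|M. S n x)"
        by (rule set_integral_mono_AE[OF ci si[OF Sint]])
          (use AEZ in \<open>eventually_elim, use bounds B(2) in blast\<close>)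
      have up: "(LINT x:B|M. S n x) \<le> (LINT x:B|M. (1 + e n) * b n)"
        by (rule set_integral_mono_AE[OF si[OF Sint] ci])
          (use AEZ in \<open>eventually_elim, use bounds B(2) in blast\<close>)
      show "(1 - e n) * b n * measure M B \<le> (\<Sum>k\<le>n. measure (density M (\<lambda>x. ennreal (f x))) (preimage_iter M T k B)) \<and>
        (\<Sum>k\<le>n. measure (density M (\<lambda>x. ennreal (f x))) (preimage_iter M T k B)) \<le> (1 + e n) * b n * measure M B"
        using lo up unfolding sum_eq cv by simp
    qed
  qed
  with e_lim show thesis by (intro that[of b e]) (auto simp: b_def d)
qed

end

lemma regularly_varying_seq_doubling:
  assumes "regularly_varying_seq u 1"
  shows "(\<lambda>n. u (2 * n) / u n) \<longlonglongrightarrow> 2"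
proof -
  obtain R where R: "regularly_varying R 1" "\<And>n. 1 \<le> n \<Longrightarrow> u n = R (real n)"
    using assms by (auto simp: regularly_varying_seq_def)
  have "((\<lambda>t. R (2 * t) / R t) \<longlongrightarrow> 2 powr 1) at_top"
    using R(1) unfolding regularly_varying_def by (metis zero_less_numeral)
  from filterlim_compose[OF this filterlim_real_sequentially]
  have "(\<lambda>n. R (2 * real n) / R (real n)) \<longlonglongrightarrow> 2" by simp
  moreover have "\<forall>\<^sub>F n in sequentially. R (2 * real n) / R (real n) = u (2 * n) / u n"
    using eventually_ge_at_top[of 1] by eventually_elim (simp add: R(2))
  ultimately show ?thesis by (rule Lim_transform_eventually)
qed

section \<open>Probabilities of long gaps between visits\<close>

text \<open>The transfer operator has disappeared: \<open>N0\<close> stands for the measure whose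
  density is provided by uniformity, which survives as an estimate of expected visits with
  normalisation \<open>b\<close> and relative error \<open>e\<close>.\<close>

locale uniformly_visited_system = recurrent_system +
  fixes N0 :: "'a measure" and b e :: "nat \<Rightarrow> real"
  assumes N0: "N0 \<in> ac_probs M" and b_pos: "\<And>n. 0 < b n" and e_null: "e \<longlonglongrightarrow> 0"
    and visits: "eventually (\<lambda>n. \<forall>B\<in>sets M. B \<subseteq> A \<longrightarrow>
        (1 - e n) * b n * measure M B \<le> (\<Sum>k\<le>n. measure N0 (preimage_iter M T k B)) \<and>
        (\<Sum>k\<le>n. measure N0 (preimage_iter M T k B)) \<le> (1 + e n) * b n * measure M B) sequentially"
    and rate_doubling: "(\<lambda>n. (\<Sum>k\<le>2 * n. q k) / (\<Sum>k\<le>n. q k)) \<longlonglongrightarrow> 2"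

sublocale uniformly_visited_system \<subseteq> tails: doubling_tail_sums q
proof
  show "decseq q"
  proof (rule decseq_SucI)
    fix n
    show "q (Suc n) \<le> q n" unfolding q_def
      using excursion_mono[of n "Suc n"] excursion_finite[of n]
      by (intro measure_mono_fmeasurable) (auto simp: fmeasurable_def)
  qed
  have "excursion 0 = A" by (auto simp: excursion_def no_visit_def A_subset_space)
  then show "0 < q 0" using A_pos A_finite by (simp add: q_def measure_def enn2real_positive_iff)
qed (use rate_doubling in \<open>simp_all add: q_def\<close>)

context uniformly_visited_system
begin

interpretation N0: prob_space N0
  using ac_probsD(1)[OF N0] .

lemma sets_N0 [measurable_cong, simp]: "sets N0 = sets M"
  by (rule ac_probsD(2)[OF N0])

lemma space_N0 [simp]: "space N0 = space M"
  by (rule ac_probsD(3)[OF N0])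

text \<open>The quantifier over \<open>j\<close> stands inside \<open>eventually\<close>, which
  allows the excursion length to grow with \<open>n\<close> later.\<close>

lemma visits_excursion:
  "eventually (\<lambda>n. \<forall>j. (1 - e n) * b n * q j \<le> (\<Sum>k\<le>n. measure N0 (preimage_iter M T k (excursion j))) \<and>
        (\<Sum>k\<le>n. measure N0 (preimage_iter M T k (excursion j))) \<le> (1 + e n) * b n * q j) sequentially"
  using visits
proof eventually_elim
  case (elim n)
  have "excursion j \<in> sets M \<and> excursion j \<subseteq> A" for j by (auto simp: excursion_def)
  with elim show ?case unfolding q_def by blast
qed

lemma preimage_excursion_mono:
  "i \<le> j \<Longrightarrow> measure N0 (preimage_iter M T k (excursion j)) \<le> measure N0 (preimage_iter M T k (excursion i))"
  using excursion_mono[of i j] preimage_iter_sets[OF excursion_sets]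
  by (intro N0.finite_measure_mono) (auto simp: preimage_iter_def)

text \<open>The last-visit decomposition involves \<open>excursion (z - k)\<close>, which depends on
  \<open>k\<close>, whereas \<open>visits\<close> handles one fixed set; shrinking all of them to
  \<open>excursion z\<close> keeps a lower bound.\<close>

lemma no_visit_lower:
  "eventually (\<lambda>m. \<forall>z\<ge>m. (1 - e m) * b m * q z \<le> measure N0 (no_visit m z)) sequentially"
  using visits_excursion
proof eventually_elim
  case (elim m)
  show ?case
  proof (intro allI impI)
    fix z assume "m \<le> z"
    have "(1 - e m) * b m * q z \<le> (\<Sum>k\<le>m. measure N0 (preimage_iter M T k (excursion z)))" using elim by blast
    also have "\<dots> \<le> (\<Sum>k\<le>m. measure N0 (preimage_iter M T k (excursion (z - k))))"
      by (intro sum_mono preimage_excursion_mono) simp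
    also have "\<dots> = measure N0 (visited_set M T A m \<inter> no_visit m z)"
      using measure_visited_no_visit[OF N0.finite_measure_axioms sets_N0 \<open>m \<le> z\<close>] by simp
    also have "\<dots> \<le> measure N0 (no_visit m z)"
      by (intro N0.finite_measure_mono) auto
    finally show "(1 - e m) * b m * q z \<le> measure N0 (no_visit m z)" .
  qed
qed

text \<open>Now every \<open>excursion (z - k)\<close> is enlarged to
  \<open>excursion (z - m)\<close>. The decomposition sees only orbits that have visited
  \<open>A\<close> by time \<open>m\<close>; the others make up the first summand, which tends to
  0.\<close>

lemma no_visit_upper:
  "eventually (\<lambda>m. \<forall>z\<ge>m. measure N0 (no_visit m z)
      \<le> (1 - measure N0 (visited_set M T A m)) + (1 + e m) * b m * q (z - m)) sequentially"
  using visits_excursion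
proof eventually_elim
  case (elim m)
  show ?case
  proof (intro allI impI)
    fix z assume "m \<le> z"
    have "measure N0 (visited_set M T A m \<inter> no_visit m z) = (\<Sum>k\<le>m. measure N0 (preimage_iter M T k (excursion (z - k))))"
      using measure_visited_no_visit[OF N0.finite_measure_axioms sets_N0 \<open>m \<le> z\<close>] .
    also have "\<dots> \<le> (\<Sum>k\<le>m. measure N0 (preimage_iter M T k (excursion (z - m))))"
      by (intro sum_mono preimage_excursion_mono) auto
    also have "\<dots> \<le> (1 + e m) * b m * q (z - m)" using elim by blast
    finally have 1: "measure N0 (visited_set M T A m \<inter> no_visit m z) \<le> (1 + e m) * b m * q (z - m)" .
    have "measure N0 (no_visit m z) \<le> measure N0 ((space N0 - visited_set M T A m) \<union> (visited_set M T A m \<inter> no_visit m z))"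
      using sets.sets_into_space[OF no_visit_sets] by (intro N0.finite_measure_mono) auto
    also have "\<dots> \<le> measure N0 (space N0 - visited_set M T A m) + measure N0 (visited_set M T A m \<inter> no_visit m z)"
      by (intro measure_Un_le) auto
    also have "measure N0 (space N0 - visited_set M T A m) = 1 - measure N0 (visited_set M T A m)"
      by (rule N0.prob_compl) simp
    finally show "measure N0 (no_visit m z)
      \<le> (1 - measure N0 (visited_set M T A m)) + (1 + e m) * b m * q (z - m)" using 1 by linarith
  qed
qed

text \<open>The asymptotic renewal equation, in the form $b_n W_n / n \longrightarrow 1$: the lower bound comes
  from summing the last-visit decomposition over $n$, the upper bound from $\nu_0(A_n) \le 1$.\<close>

lemma b_asymp: "(\<lambda>n. b n * tails.w n) \<longlonglongrightarrow> 1"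
proof (rule tendsto_sandwich)
  define u where "u = (\<lambda>m. measure N0 (visited_set M T A m))"
  have ue: "u m = (\<Sum>k\<le>m. measure N0 (preimage_iter M T k (excursion (m - k))))" for m
  proof -
    \<comment> \<open>For \<open>z = m\<close> the window is empty, and the decomposition becomes a
      renewal equation for \<open>u\<close>.\<close>
    have "visited_set M T A m \<inter> no_visit m m = visited_set M T A m"
      by (auto simp: no_visit_def visited_set_def preimage_iter_def)
    then show ?thesis
      using measure_visited_no_visit[OF N0.finite_measure_axioms sets_N0, of m m] by (simp add: u_def)
  qed
  have avg: "(\<lambda>n. (\<Sum>m\<le>n. u m) / real n) \<longlonglongrightarrow> 1"
  proof (rule average_tendsto_1)
    show "incseq u" unfolding incseq_def u_def
      by (intro allI impI N0.finite_measure_mono visited_set_mono) auto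
    show "u \<longlonglongrightarrow> 1" unfolding u_def by (rule visited_set_tendsto_1[OF N0])
  qed (auto simp: u_def)
  have e1: "(\<lambda>n. 1 + e n) \<longlonglongrightarrow> 1 + 0" "(\<lambda>n. 1 - e n) \<longlonglongrightarrow> 1 - 0"
    by (intro tendsto_intros e_null)+
  have ev: "eventually (\<lambda>n. 0 < 1 + e n) sequentially" "eventually (\<lambda>n. 0 < 1 - e n) sequentially"
    using order_tendstoD(1)[OF e1(1), of 0] order_tendstoD(1)[OF e1(2), of 0] by auto
  show "(\<lambda>n. ((\<Sum>m\<le>n. u m) / real n) / (1 + e n)) \<longlonglongrightarrow> 1"
    using tendsto_divide[OF avg e1(1)] by simp
  show "eventually (\<lambda>n. ((\<Sum>m\<le>n. u m) / real n) / (1 + e n) \<le> b n * tails.w n) sequentially"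
    using visits_excursion ev(1) eventually_ge_at_top[of 1]
  proof eventually_elim
    case (elim n)
    let ?g = "\<lambda>k j. measure N0 (preimage_iter M T k (excursion j))"
    \<comment> \<open>Summed over \<open>m\<close>, the pairs \<open>(k, j)\<close> with
      \<open>k + j = m\<close> fill a triangle. Enlarging it to a square completes the sum over
      \<open>k\<close> for each fixed \<open>j\<close>, as \<open>visits_excursion\<close>
      requires.\<close>
    have "(\<Sum>m\<le>n. u m) = (\<Sum>(k, j)\<in>{(k, j). k + j \<le> n}. ?g k j)"
      unfolding ue by (rule sum.triangle_reindex_eq[symmetric])
    also have "\<dots> \<le> (\<Sum>(k, j)\<in>{..n} \<times> {..n}. ?g k j)" by (rule sum_mono2) auto
    also have "\<dots> = (\<Sum>j\<le>n. \<Sum>k\<le>n. ?g k j)"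
      unfolding sum.cartesian_product[symmetric] by (rule sum.swap)
    also have "\<dots> \<le> (\<Sum>j\<le>n. (1 + e n) * b n * q j)" using elim by (intro sum_mono) blast
    also have "\<dots> = (1 + e n) * b n * tails.W n" by (simp add: tails.W_def sum_distrib_left)
    finally have "(\<Sum>m\<le>n. u m) / real n \<le> (1 + e n) * b n * tails.W n / real n" by (rule divide_right_mono) simp
    then show ?case using elim by (simp add: tails.w_def divide_le_eq mult.commute mult.left_commute)
  qed
  show "(\<lambda>n. 1 / ((1 - e n) * (q n / tails.w n))) \<longlonglongrightarrow> 1"
    using tendsto_divide[OF tendsto_const[of 1] tendsto_mult[OF e1(2) tails.q_asymp]] by simp
  have "eventually (\<lambda>n. 0 < q n / tails.w n) sequentially"
    using order_tendstoD(1)[OF tails.q_asymp, of 0] by simp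
  then show "eventually (\<lambda>n. b n * tails.w n \<le> 1 / ((1 - e n) * (q n / tails.w n))) sequentially"
    using no_visit_lower ev(2) eventually_ge_at_top[of 1]
  proof eventually_elim
    case (elim n)
    \<comment> \<open>An empty window again, now bounded by probability 1; the factor
      \<open>q n / w n\<close> in the upper sequence exchanges \<open>q n\<close> for
      \<open>w n\<close>.\<close>
    have "(1 - e n) * b n * q n \<le> measure N0 (no_visit n n)" using elim by blast
    also have "\<dots> \<le> 1" by (rule N0.prob_le_1)
    finally have le: "(1 - e n) * b n * q n \<le> 1" .
    have w: "0 < tails.w n" using elim by (intro tails.w_pos)
    have pos: "0 < (1 - e n) * (q n / tails.w n)" using elim by (intro mult_pos_pos) auto
    have "(b n * tails.w n) * ((1 - e n) * (q n / tails.w n)) = (1 - e n) * b n * q n"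
      using w by simp
    with le show ?case using pos by (simp only: pos_le_divide_eq)
  qed
qed

text \<open>The two windows end \<open>n\<close> steps apart, which is the possible distance between
  \<open>U_n\<close> and \<open>Y_n\<close>. Each bound passes between \<open>N\<close> and
  \<open>N0\<close> by averaging over about \<open>n / 2\<close> or \<open>n\<close> shifts, which
  the much larger level absorbs.\<close>

lemma no_visit_level_limits:
  assumes N: "N \<in> ac_probs M" and t: "0 < t" "t < 1"
  obtains l r where "l \<longlonglongrightarrow> t" "r \<longlonglongrightarrow> t"
    "eventually (\<lambda>n. l n \<le> measure N (no_visit n (tails.level t n + n - 1))) sequentially"
    "eventually (\<lambda>n. measure N (no_visit n (tails.level t n - 1)) \<le> r n) sequentially"
proof -
  let ?y = "tails.level t"
  note level_limit = tails.level_limit[OF q_tendsto_0 t b_asymp]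
  \<comment> \<open>The factor 8 ensures that removing \<open>1 + 3 * n\<close> from
    \<open>?y n\<close> leaves at least half of it, as \<open>rb\<close> needs.\<close>
  have y8: "eventually (\<lambda>n. 8 * n \<le> ?y n) sequentially"
    using tails.level_ge[OF q_tendsto_0 t, of 3] by simp
  have h: "filterlim (\<lambda>n::nat. n div 2) at_top sequentially"
    unfolding filterlim_at_top
  proof
    fix Z show "eventually (\<lambda>n::nat. Z \<le> n div 2) sequentially"
      using eventually_ge_at_top[of "2 * Z"] by eventually_elim auto
  qed
  have nh: "filterlim (\<lambda>n::nat. n - n div 2) at_top sequentially"
    by (rule filterlim_at_top_mono[OF h]) (auto intro!: always_eventually)
  have n2: "filterlim (\<lambda>n::nat. n + n) at_top sequentially"
    by (rule filterlim_at_top_mono[OF filterlim_ident]) auto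
  \<comment> \<open>Using \<open>n - n div 2\<close> shifts from the start \<open>n div 2\<close>
    moves the left end exactly to \<open>n\<close>, while the start itself stays comparable with
    \<open>n\<close>.\<close>
  define z where "z = (\<lambda>n. ?y n + n - 1 + (n - n div 2))"
  obtain \<delta> where \<delta>: "\<delta> \<longlonglongrightarrow> (0::real)"
    "eventually (\<lambda>n. measure N0 (no_visit (n div 2) (?y n + n - 1 + (n - n div 2))) + \<delta> n
       \<le> measure N (no_visit (n div 2 + (n - n div 2)) (?y n + n - 1))) sequentially"
    using no_visit_change_of_measure[OF N N0 nh, of "\<lambda>n. n div 2" "\<lambda>n. ?y n + n - 1"] by blast
  \<comment> \<open>The roles of \<open>N\<close> and \<open>N0\<close> are exchanged: the longer
    window now belongs to \<open>N\<close>, and \<open>n\<close> shifts move its left end from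
    \<open>n\<close> to \<open>n + n\<close>.\<close>
  obtain \<delta>' where \<delta>': "\<delta>' \<longlonglongrightarrow> (0::real)"
    "eventually (\<lambda>n. measure N (no_visit n (?y n - 1 - n + n)) + \<delta>' n
       \<le> measure N0 (no_visit (n + n) (?y n - 1 - n))) sequentially"
    using no_visit_change_of_measure[OF N0 N filterlim_ident, of "\<lambda>n. n" "\<lambda>n. ?y n - 1 - n"] by blast
  define l where "l = (\<lambda>n. (1 - e (n div 2)) * (b (n div 2) * q (z n)) + \<delta> n)"
  define r where "r = (\<lambda>n. (1 - measure N0 (visited_set M T A (n + n)))
      + (1 + e (n + n)) * (b (n + n) * q (?y n - 1 - n - (n + n))) - \<delta>' n)"
  have lb: "(\<lambda>n. b (n div 2) * q (z n)) \<longlonglongrightarrow> t"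
  proof (rule level_limit[where i=2 and j=0 and k=1 and l=2])
    show "eventually (\<lambda>n. n \<le> 2 ^ 2 * (n div 2)) sequentially"
      using eventually_ge_at_top[of "2::nat"]
    proof eventually_elim
      case (elim n)
      then have "n \<le> 4 * (n div 2)" by presburger
      then show ?case by simp
    qed
    show "eventually (\<lambda>n. ?y n \<le> 2 ^ 1 * z n) sequentially"
      using y8 eventually_ge_at_top[of "1::nat"] by eventually_elim (auto simp: z_def)
    show "eventually (\<lambda>n. z n \<le> 2 ^ 2 * ?y n) sequentially"
      using y8 by eventually_elim (auto simp: z_def)
  qed auto
  have rb: "(\<lambda>n. b (n + n) * q (?y n - 1 - n - (n + n))) \<longlonglongrightarrow> t"
  proof (rule level_limit[where i=0 and j=1 and k=1 and l=0])
    show "eventually (\<lambda>n. ?y n \<le> 2 ^ 1 * (?y n - 1 - n - (n + n))) sequentially"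
      using y8 eventually_ge_at_top[of "1::nat"] by eventually_elim auto
  qed auto
  have "l \<longlonglongrightarrow> (1 - 0) * t + 0" unfolding l_def
    by (intro tendsto_intros filterlim_compose[OF e_null h] lb \<delta>(1))
  moreover have "r \<longlonglongrightarrow> (1 - 1) + (1 + 0) * t - 0" unfolding r_def
    by (intro tendsto_intros filterlim_compose[OF e_null n2] rb \<delta>'(1)
        filterlim_compose[OF visited_set_tendsto_1[OF N0] n2])
  moreover have "eventually (\<lambda>n. l n \<le> measure N (no_visit n (?y n + n - 1))) sequentially"
    using eventually_compose_filterlim[OF no_visit_lower h] \<delta>(2) y8
  proof eventually_elim
    case (elim n)
    have "n div 2 \<le> z n" using elim(3) by (auto simp: z_def)
    then have "(1 - e (n div 2)) * b (n div 2) * q (z n) \<le> measure N0 (no_visit (n div 2) (z n))"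
      using elim(1) by blast
    moreover have "n div 2 + (n - n div 2) = n" by simp
    ultimately show ?case using elim(2) by (simp add: l_def z_def mult.assoc)
  qed
  moreover have "eventually (\<lambda>n. measure N (no_visit n (?y n - 1)) \<le> r n) sequentially"
    using eventually_compose_filterlim[OF no_visit_upper n2] \<delta>'(2) y8 eventually_ge_at_top[of 1]
  proof eventually_elim
    case (elim n)
    have "n + n \<le> ?y n - 1 - n" using elim(3,4) by auto
    then have "measure N0 (no_visit (n + n) (?y n - 1 - n)) \<le> (1 - measure N0 (visited_set M T A (n + n)))
        + (1 + e (n + n)) * b (n + n) * q (?y n - 1 - n - (n + n))"
      using elim(1) by blast
    moreover have "?y n - 1 - n + n = ?y n - 1" using elim(3,4) by auto
    ultimately show ?case using elim(2) by (simp add: r_def mult.assoc)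
  qed
  ultimately show thesis by (intro that) auto
qed

section \<open>Convergence of the two processes\<close>

text \<open>Recurrence guarantees that the \<open>LEAST\<close> in \<open>next_visit\<close> is
  attained; by \<open>AE_recurrent\<close> this covers almost every point.\<close>

lemma recurrent_next_visit:
  assumes "x \<in> recurrence_set A"
  shows "n < next_visit T A n x" and "z < next_visit T A n x \<longleftrightarrow> x \<in> no_visit n z \<or> z \<le> n"
proof -
  have xs: "x \<in> space M" using assms by (simp add: recurrence_set_def)
  obtain k where k: "Suc n \<le> k" "(T ^^ k) x \<in> A" using assms unfolding recurrence_set_def by blast
  then have "\<exists>k. n < k \<and> (T ^^ k) x \<in> A" by (auto intro: exI[of _ k])
  from LeastI_ex[OF this] have L: "n < next_visit T A n x" "(T ^^ next_visit T A n x) x \<in> A"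
    unfolding next_visit_def by auto
  show "n < next_visit T A n x" by fact
  have le: "next_visit T A n x \<le> k" if "n < k" "(T ^^ k) x \<in> A" for k
    unfolding next_visit_def using that by (intro Least_le) simp
  show "z < next_visit T A n x \<longleftrightarrow> x \<in> no_visit n z \<or> z \<le> n"
  proof
    assume "z < next_visit T A n x"
    then show "x \<in> no_visit n z \<or> z \<le> n" using le xs by (fastforce simp: no_visit_def)
  next
    assume "x \<in> no_visit n z \<or> z \<le> n"
    then show "z < next_visit T A n x" using L by (fastforce simp: no_visit_def not_le[symmetric])
  qed
qed

text \<open>For \<open>n \<ge> 1\<close> and recurrent \<open>x\<close> the quotient is
  \<open>w (U n x) / w n\<close>, so it is at most \<open>t\<close> exactly when
  \<open>U n x\<close> has reached the level. The bounds on \<open>U\<close> squeeze this event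
  between the two events of \<open>no_visit_level_limits\<close>, so one statement serves both
  processes.\<close>

lemma normalized_rate_converges:
  assumes U[measurable]: "\<And>n. U n \<in> measurable M (count_space UNIV)"
    and U_bounds: "\<And>n x. x \<in> recurrence_set A \<Longrightarrow> 1 \<le> U n x \<and> U n x \<le> next_visit T A n x \<and> next_visit T A n x \<le> U n x + n"
  shows "strong_conv_distr M
      (\<lambda>n x. real n * tail_sum M T A (U n x) / (measure M (visited_set M T A n) * real (U n x)))
      (uniform_measure lborel {0..1})" (is "strong_conv_distr M ?X _")
  unfolding strong_conv_distr_def
proof (intro conjI allI ballI)
  show meas: "?X n \<in> borel_measurable M" for n
    using measurable_compose[OF U[of n], of "\<lambda>u. real n * tail_sum M T A u / (measure M (visited_set M T A n) * real u)" borel]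
    by simp
  fix N assume N: "N \<in> ac_probs M"
  interpret N: prob_space N using ac_probsD(1)[OF N] .
  note sN = ac_probsD(2,3)[OF N]
  have measN: "?X n \<in> borel_measurable N" for n
    using meas[of n] unfolding measurable_cong_sets[OF sN(1) refl] .
  show "weak_conv_m (\<lambda>n. distr N borel (?X n)) (uniform_measure lborel {0..1})"
  proof (rule weak_conv_uniform_01[OF N.prob_space_axioms measN])
    fix t :: real assume t: "0 < t" "t < 1"
    let ?y = "tails.level t"
    have X: "?X n x \<le> t \<longleftrightarrow> ?y n \<le> U n x" if n: "1 \<le> n" and x: "x \<in> recurrence_set A" for n x
    proof -
      have u1: "1 \<le> U n x" using U_bounds[OF x, of n] by simp
      have "?X n x = tails.w (U n x) / tails.w n"
        using wandering_rate_eq[of n] n by (simp add: tail_sum_eq tails.w_def tails.W_def wandering_rate_def ac_simps)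
      then show ?thesis
        using tails.level_le_iff[OF q_tendsto_0 t n u1] tails.w_pos[OF n] by (simp add: divide_le_eq)
    qed
    have sets_X: "{x\<in>space N. ?X n x \<le> t} \<in> sets N" for n
      using measN[of n] by measurable
    have AE_rec: "AE x in N. x \<in> recurrence_set A" by (rule ac_probsD(4)[OF N AE_recurrent])
    obtain l r where lr: "l \<longlonglongrightarrow> t" "r \<longlonglongrightarrow> t"
      "eventually (\<lambda>n. l n \<le> measure N (no_visit n (?y n + n - 1))) sequentially"
      "eventually (\<lambda>n. measure N (no_visit n (?y n - 1)) \<le> r n) sequentially"
      using no_visit_level_limits[OF N t] by blast
    have y2: "eventually (\<lambda>n. 2 * n \<le> ?y n) sequentially"
      using tails.level_ge[OF q_tendsto_0 t, of 1] by simp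
    show "(\<lambda>n. measure N {x\<in>space N. ?X n x \<le> t}) \<longlonglongrightarrow> t"
    proof (rule tendsto_sandwich[OF _ _ lr(1,2)])
      show "eventually (\<lambda>n. l n \<le> measure N {x\<in>space N. ?X n x \<le> t}) sequentially"
        using lr(3) y2 eventually_ge_at_top[of 1]
      proof eventually_elim
        case (elim n)
        have "measure N (no_visit n (?y n + n - 1)) \<le> measure N {x\<in>space N. ?X n x \<le> t}"
        proof (rule N.finite_measure_mono_AE[OF _ sets_X])
          show "AE x in N. x \<in> no_visit n (?y n + n - 1) \<longrightarrow> x \<in> {x\<in>space N. ?X n x \<le> t}"
            using AE_rec AE_space
          proof eventually_elim
            fix x assume x: "x \<in> recurrence_set A" "x \<in> space N"
            show "x \<in> no_visit n (?y n + n - 1) \<longrightarrow> x \<in> {x\<in>space N. ?X n x \<le> t}"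
            proof
              assume "x \<in> no_visit n (?y n + n - 1)"
              then have "?y n + n - 1 < next_visit T A n x" using recurrent_next_visit[OF x(1)] by blast
              then have "?y n \<le> U n x" using U_bounds[OF x(1), of n] by linarith
              then show "x \<in> {x\<in>space N. ?X n x \<le> t}" using X[OF elim(3) x(1)] x(2) by blast
            qed
          qed
        qed
        with elim show ?case by linarith
      qed
      show "eventually (\<lambda>n. measure N {x\<in>space N. ?X n x \<le> t} \<le> r n) sequentially"
        using lr(4) y2 eventually_ge_at_top[of 1]
      proof eventually_elim
        case (elim n)
        have "measure N {x\<in>space N. ?X n x \<le> t} \<le> measure N (no_visit n (?y n - 1))"
        proof (rule N.finite_measure_mono_AE)
          show "no_visit n (?y n - 1) \<in> sets N" using sN by simp
          show "AE x in N. x \<in> {x\<in>space N. ?X n x \<le> t} \<longrightarrow> x \<in> no_visit n (?y n - 1)"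
            using AE_rec
          proof eventually_elim
            fix x assume x: "x \<in> recurrence_set A"
            show "x \<in> {x\<in>space N. ?X n x \<le> t} \<longrightarrow> x \<in> no_visit n (?y n - 1)"
            proof
              assume "x \<in> {x\<in>space N. ?X n x \<le> t}"
              then have "?y n \<le> U n x" using X[OF elim(3) x] by blast
              then have "?y n - 1 < next_visit T A n x" using U_bounds[OF x, of n] elim(2,3) by linarith
              moreover have "x \<in> space M" using x by (simp add: recurrence_set_def)
              \<comment> \<open>If \<open>?y n - 1 \<le> n\<close> the window is empty; this settles
                the second disjunct of \<open>recurrent_next_visit\<close>.\<close>
              then have "x \<in> no_visit n n" by (auto simp: no_visit_def)
              ultimately show "x \<in> no_visit n (?y n - 1)"
                using recurrent_next_visit(2)[OF x] no_visit_mono[of n n "?y n - 1" n] by blast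
            qed
          qed
        qed
        with elim show ?case by linarith
      qed
    qed
  qed
qed

lemma measurable_next_visit[measurable]: "next_visit T A n \<in> measurable M (count_space UNIV)"
  unfolding next_visit_def[abs_def] by measurable

lemma measurable_last_visit[measurable]: "last_visit M T A n \<in> measurable M (count_space UNIV)"
  unfolding last_visit_def[abs_def] by measurable

lemma measurable_spanning_time[measurable]: "spanning_time M T A n \<in> measurable M (count_space UNIV)"
  unfolding spanning_time_def[abs_def] by measurable

lemma last_visit_le: "last_visit M T A n x \<le> n"
proof (cases "x \<in> visited_set M T A n")
  case True
  then have "{k. k \<le> n \<and> (T ^^ k) x \<in> A} \<noteq> {}" by (auto simp: visited_set_def preimage_iter_def)
  with True show ?thesis by (simp add: last_visit_def)
qed (simp add: last_visit_def)

text \<open>Here \<open>U\<close> is the spanning time, which falls short of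
  \<open>next_visit\<close> by the last visit and so by at most \<open>n\<close>.\<close>

lemma Gamma_converges: "strong_conv_distr M (Gamma_proc M T A) (uniform_measure lborel {0..1})"
  unfolding Gamma_proc_def[abs_def]
proof (rule normalized_rate_converges)
  fix n x assume x: "x \<in> recurrence_set A"
  show "1 \<le> spanning_time M T A n x \<and> spanning_time M T A n x \<le> next_visit T A n x
      \<and> next_visit T A n x \<le> spanning_time M T A n x + n"
    using recurrent_next_visit(1)[OF x, of n] last_visit_le[of n x] by (auto simp: spanning_time_def)
qed measurable

lemma Theta_converges: "strong_conv_distr M (Theta_proc M T A) (uniform_measure lborel {0..1})"
  unfolding Theta_proc_def[abs_def]
proof (rule normalized_rate_converges)
  fix n x assume x: "x \<in> recurrence_set A"
  show "1 \<le> next_visit T A n x \<and> next_visit T A n x \<le> next_visit T A n x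
      \<and> next_visit T A n x \<le> next_visit T A n x + n"
    using recurrent_next_visit(1)[OF x, of n] by auto
qed measurable

end

theorem theorem2p3:
  fixes M :: "'a measure" and T :: "'a \<Rightarrow> 'a" and A :: "'a set"
  assumes "sigma_finite_measure M" and "emeasure M (space M) = \<infinity>"
    and "measure_preserving M T" and "conservative M T" and "ergodic M T"
    and "A \<in> sets M" and "0 < emeasure M A" and "emeasure M A < \<infinity>"
    and "uniform_set M T A"
    and "regularly_varying_seq (wandering_rate M T A) 1"
  shows "strong_conv_distr M (Gamma_proc M T A) (uniform_measure lborel {0..1})
       \<and> strong_conv_distr M (Theta_proc M T A) (uniform_measure lborel {0..1})"
proof -
  interpret sigma_finite_measure M by (rule assms(1))
  interpret recurrent_system M T A by unfold_locales (rule assms)+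
  obtain f where f: "f \<in> ac_prob_densities M" "uniform_for M T A f"
    using assms(9) by (auto simp: uniform_set_def)
  obtain b e where be: "\<And>n. 0 < b n" "e \<longlonglongrightarrow> 0"
    "eventually (\<lambda>n. \<forall>B\<in>sets M. B \<subseteq> A \<longrightarrow>
        (1 - e n) * b n * measure M B \<le> (\<Sum>k\<le>n. measure (density M (\<lambda>x. ennreal (f x))) (preimage_iter M T k B)) \<and>
        (\<Sum>k\<le>n. measure (density M (\<lambda>x. ennreal (f x))) (preimage_iter M T k B)) \<le> (1 + e n) * b n * measure M B) sequentially"
    using uniform_for_expected_visits[OF assms(6-8) f] by blast
  have "(\<lambda>n. (\<Sum>k\<le>2 * n. q k) / (\<Sum>k\<le>n. q k)) \<longlonglongrightarrow> 2"
    using regularly_varying_seq_doubling[OF assms(10)] by (simp add: wandering_rate_eq)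
  then interpret uniformly_visited_system M T A "density M (\<lambda>x. ennreal (f x))" b e
    using f(1) be by unfold_locales (auto simp: ac_prob_densities_def)
  show ?thesis using Gamma_converges Theta_converges by blast
qed

end
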